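(* Fix an integer $n\ge2$. The cyclic Tamari lattice (that is, the poset $\mathsf{CTam}_{312}$ of $312$-avoiding TITOs, or equivalently the isomorphic poset $\mathsf{CTam}_{\mathsf{Tree}}$ of TIBITs) is a finite lattice. Moreover, the cyclic sylvester congruence is a complete lattice congruence on $\mathsf{CDyer}$, and the map $\mathscr T\colon\mathsf{CDyer}\to\mathsf{CTam}_{\mathsf{Tree}}$ is a surjective homomorphism of complete lattices.
   Context: Fix an integer $n\ge 2$. A translation-invariant total order (TITO) is a total order $\preceq$ on $\mathbb Z$ such that $a\preceq b$ iff $a+n\preceq b+n$. A reflection index is a pair $(a,b)$ of integers with $a<b$, considered up to simultaneous translation by multiples of $n$. An inversion of $\preceq$ is a reflection index $(a,b)$ with $b\preceq a$; $\mathrm{Inv}(\preceq)$ is the set of inversions. $\mathsf{CDyer}$ (the cyclic Dyer lattice) is the set of all TITOs ordered by $\preceq_1\,\le\,\preceq_2$ iff $\mathrm{Inv}(\preceq_1)\subseteq\mathrm{Inv}(\preceq_2)$; it is known to be a complete lattice. A TITO is $312$-avoiding if there are no integers $a<b<c$ with $c\preceq a\preceq b$. $\mathsf{CTam}_{312}$ is the subposet of $\mathsf{CDyer}$ consisting of $312$-avoiding TITOs. A binary tree is a (possibly infinite) plane tree in which each node has at most one left child and at most one right child, each node is the (left or right, not both) child of at most one node (its parent, if it exists), and any two nodes have a common ancestor (each node is an ancestor of itself). The left (right) subtree of $v$ consists of the descendants of its left (right) child. In-order: the unique total order on nodes in which, for every $v$, the left subtree of $v$ precedes $v$, which precedes the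 right subtree of $v$. Post-order: the unique total order in which, for every $v$, the left subtree of $v$ precedes the right subtree of $v$, which precedes $v$. A TIBIT is a binary tree $T$ with node set $\{v_a\mid a\in\mathbb Z\}$ such that $a<b$ iff $v_a$ precedes $v_b$ in in-order, and $v_a$ is the left (resp. right) child of $v_b$ iff $v_{a+n}$ is the left (resp. right) child of $v_{b+n}$. For a TIBIT $T$, $\sqsubseteq_T$ is the TITO obtained by reading node indices in post-order. $\mathsf{CTam}_{\mathsf{Tree}}$ is the set of TIBITs ordered by $T_1\le T_2$ iff $\sqsubseteq_{T_1}\,\le\,\sqsubseteq_{T_2}$ in $\mathsf{CDyer}$; the map $T\mapsto\,\sqsubseteq_T$ is an isomorphism $\mathsf{CTam}_{\mathsf{Tree}}\to\mathsf{CTam}_{312}$. A linear extension of a TIBIT $T$ is a total order $\preceq$ on $\mathbb Z$ with $a\preceq b$ whenever $v_a$ is a child of $v_b$. For each TITO $\preceq$ there is a unique TIBIT having $\preceq$ as a linear extension; it is denoted $\mathscr T(\preceq)$. The cyclic sylvester congruence is the equivalence relation on $\mathsf{CDyer}$ in which $\preceq_1$ and $\preceq_2$ are equivalent iff $\mathscr T(\preceq_1)=\mathscr T(\preceq_2)$. A homomorphism of complete lattices is a map preserving meets and joins of arbitrary subsets. An equivalence relation $\equiv$ on a complete lattice $L$ whose classes are intervals is a complete lattice congruence if the set $L'$ of minimum elements of classes is a complete lattice (in the induced order) and the map $L\to L'$ sending each element to the minimum of its class is a homomorphism of complete lattices. *)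

theory Defs
  imports "HOL-Algebra.Complete_Lattice"
begin

section \<open>Translation-invariant total orders\<close>

text \<open>Orders on the integers are relations: \<open>(a, b) \<in> r\<close> stands for \<open>a \<preceq> b\<close>.\<close>

definition TITO :: "int \<Rightarrow> int rel set" where
  "TITO n = {r. linear_order_on UNIV r \<and> (\<forall>a b. (a, b) \<in> r \<longleftrightarrow> (a + n, b + n) \<in> r)}"

definition translation_equiv :: "int \<Rightarrow> ((int \<times> int) \<times> (int \<times> int)) set" where
  "translation_equiv n = {((a, b), (a', b')). \<exists>k. a' = a + k * n \<and> b' = b + k * n}"

definition reflection_index :: "int \<Rightarrow> int \<Rightarrow> int \<Rightarrow> (int \<times> int) set" where
  "reflection_index n a b = translation_equiv n `` {(a, b)}"

definition Inv :: "int \<Rightarrow> int rel \<Rightarrow> (int \<times> int) set set" where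
  "Inv n r = {reflection_index n a b | a b. a < b \<and> (b, a) \<in> r}"

definition CDyer :: "int \<Rightarrow> int rel gorder" where
  "CDyer n = \<lparr>carrier = TITO n, eq = (=), le = (\<lambda>r s. Inv n r \<subseteq> Inv n s)\<rparr>"

definition avoids_312 :: "int rel \<Rightarrow> bool" where
  "avoids_312 r \<longleftrightarrow> \<not> (\<exists>a b c. a < b \<and> b < c \<and> (c, a) \<in> r \<and> (a, b) \<in> r)"

definition CTam312 :: "int \<Rightarrow> int rel gorder" where
  "CTam312 n = (CDyer n)\<lparr>carrier := {r \<in> TITO n. avoids_312 r}\<rparr>"


section \<open>Binary trees and TIBITs\<close>

text \<open>The nodes of a tree are all the elements of the type \<open>'v\<close>.\<close>

record 'v btree =
  left_child :: "'v \<Rightarrow> 'v option"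
  right_child :: "'v \<Rightarrow> 'v option"

definition child_rel :: "'v btree \<Rightarrow> 'v rel" where
  "child_rel T = {(c, v). left_child T v = Some c \<or> right_child T v = Some c}"

text \<open>\<open>(u, v) \<in> descendant_rel T\<close> means that \<open>u\<close> is a descendant of \<open>v\<close>, equivalently
  that \<open>v\<close> is an ancestor of \<open>u\<close>; every node is an ancestor of itself.\<close>

definition descendant_rel :: "'v btree \<Rightarrow> 'v rel" where
  "descendant_rel T = (child_rel T)\<^sup>*"

text \<open>There need not be a root. Since parents are unique and any two nodes have a common
  ancestor, a directed cycle is the only way in which the graph could fail to be a tree.\<close>

definition binary_tree :: "'v btree \<Rightarrow> bool" where
  "binary_tree T \<longleftrightarrow>
     acyclic (child_rel T) \<and>
     (\<forall>c v w. (c, v) \<in> child_rel T \<and> (c, w) \<in> child_rel T \<longrightarrow> v = w) \<and>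
     (\<forall>c v. \<not> (left_child T v = Some c \<and> right_child T v = Some c)) \<and>
     (\<forall>u v. \<exists>w. (u, w) \<in> descendant_rel T \<and> (v, w) \<in> descendant_rel T)"

definition left_subtree :: "'v btree \<Rightarrow> 'v \<Rightarrow> 'v set" where
  "left_subtree T v = {u. \<exists>c. left_child T v = Some c \<and> (u, c) \<in> descendant_rel T}"

definition right_subtree :: "'v btree \<Rightarrow> 'v \<Rightarrow> 'v set" where
  "right_subtree T v = {u. \<exists>c. right_child T v = Some c \<and> (u, c) \<in> descendant_rel T}"

definition in_order :: "'v btree \<Rightarrow> 'v rel" where
  "in_order T = (THE r. linear_order_on UNIV r \<and>
     (\<forall>v. (\<forall>u \<in> left_subtree T v. (u, v) \<in> r) \<and>
          (\<forall>w \<in> right_subtree T v. (v, w) \<in> r)))"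

text \<open>The last condition also covers the nodes whose right subtree is empty.\<close>

definition post_order :: "'v btree \<Rightarrow> 'v rel" where
  "post_order T = (THE r. linear_order_on UNIV r \<and>
     (\<forall>v. (\<forall>u \<in> left_subtree T v. \<forall>w \<in> right_subtree T v. (u, w) \<in> r) \<and>
          (\<forall>u \<in> left_subtree T v \<union> right_subtree T v. (u, v) \<in> r)))"

text \<open>The node \<open>v\<^sub>a\<close> is identified with its index \<open>a\<close>.\<close>

definition TIBIT :: "int \<Rightarrow> int btree set" where
  "TIBIT n = {T. binary_tree T \<and>
     (\<forall>a b. a < b \<longleftrightarrow> (a, b) \<in> in_order T \<and> a \<noteq> b) \<and>
     (\<forall>a b. left_child T b = Some a \<longleftrightarrow> left_child T (b + n) = Some (a + n)) \<and>
     (\<forall>a b. right_child T b = Some a \<longleftrightarrow> right_child T (b + n) = Some (a + n))}"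

definition CTamTree :: "int \<Rightarrow> int btree gorder" where
  "CTamTree n = \<lparr>carrier = TIBIT n, eq = (=),
     le = (\<lambda>S T. post_order S \<sqsubseteq>\<^bsub>CDyer n\<^esub> post_order T)\<rparr>"

definition linear_extension :: "int btree \<Rightarrow> int rel \<Rightarrow> bool" where
  "linear_extension T r \<longleftrightarrow> linear_order_on UNIV r \<and> child_rel T \<subseteq> r"

definition tree_of :: "int \<Rightarrow> int rel \<Rightarrow> int btree" where
  "tree_of n r = (THE T. T \<in> TIBIT n \<and> linear_extension T r)"

definition cyclic_sylvester :: "int \<Rightarrow> int rel rel" where
  "cyclic_sylvester n = {(r, s). r \<in> TITO n \<and> s \<in> TITO n \<and> tree_of n r = tree_of n s}"


section \<open>Complete lattice homomorphisms and congruences\<close>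

text \<open>\<open>sup_pres\<close> and \<open>inf_pres\<close> include that both sides are complete lattices, but not that
  the map sends one carrier into the other. They range over all subsets, including the empty one.\<close>

definition complete_lattice_hom :: "'a gorder \<Rightarrow> 'b gorder \<Rightarrow> ('a \<Rightarrow> 'b) \<Rightarrow> bool" where
  "complete_lattice_hom L M f \<longleftrightarrow>
     f ` carrier L \<subseteq> carrier M \<and> sup_pres L M f \<and> inf_pres L M f"

definition is_interval :: "'a gorder \<Rightarrow> 'a set \<Rightarrow> bool" where
  "is_interval L C \<longleftrightarrow>
     (\<exists>l\<in>carrier L. \<exists>u\<in>carrier L. l \<sqsubseteq>\<^bsub>L\<^esub> u \<and> C = \<lbrace>l..u\<rbrace>\<^bsub>L\<^esub>)"

definition class_min :: "'a gorder \<Rightarrow> 'a rel \<Rightarrow> 'a \<Rightarrow> 'a" where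
  "class_min L E x = (THE m. least L m (E `` {x}))"

definition class_minima :: "'a gorder \<Rightarrow> 'a rel \<Rightarrow> 'a gorder" where
  "class_minima L E = L\<lparr>carrier := {m. \<exists>C \<in> carrier L // E. least L m C}\<rparr>"

definition complete_lattice_congruence :: "'a gorder \<Rightarrow> 'a rel \<Rightarrow> bool" where
  "complete_lattice_congruence L E \<longleftrightarrow>
     complete_lattice L \<and> equiv (carrier L) E \<and>
     (\<forall>C \<in> carrier L // E. is_interval L C) \<and>
     complete_lattice (class_minima L E) \<and>
     complete_lattice_hom L (class_minima L E) (class_min L E)"

end

theory Submission
  imports Defs
begin

text \<open>
  The tree of a total order can be read off without constructing it. For a total order \<open>r\<close> on the
  integers, say that \<open>v\<close> dominates \<open>u\<close> if \<open>v\<close> is the \<open>r\<close>-largest of the integers between \<open>u\<close> and \<open>v\<close>.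
  Dominance is a partial order in which the integers dominated by \<open>v\<close> form an interval and two integers
  always have a common dominator between them (locale \<open>descendant_order\<close>). The descendant relation of a
  TIBIT has the same properties, because its in-order is the usual order. A total order which extends
  a relation \<open>D\<close> with these properties has \<open>D\<close> as its dominance relation (\<open>dominance_eq\<close>). Hence the
  TIBITs with linear extension \<open>r\<close> are those whose descendant relation is the dominance relation of \<open>r\<close>.
  There is at most one, since children are the topmost descendants on their side; translation invariance
  of \<open>r\<close> makes the topmost descendants exist and generate the whole relation, so there is one
  (\<open>dominance_branching_order\<close>, \<open>tree_of_eq\<close>).

  Among the linear extensions of \<open>D\<close>, one has the fewest inversions (\<open>lower_order D\<close>, which is the
  post-order of the tree) and one has the most (\<open>upper_order D\<close>), and all orders between them in the
  cyclic Dyer lattice are linear extensions of \<open>D\<close>. So the sylvester classes are intervals. The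
  orders that are minimal in their class are those that avoid \<open>312\<close>
  (\<open>eq_lower_order_if_avoids_312\<close>).

  The passages from \<open>r\<close> to the minimum and to the maximum of its class are both monotone. Therefore the
  map from \<open>r\<close> to the minimum of its class has a lower adjoint, the inclusion of the class minima, and
  an upper adjoint, which sends a class minimum to the maximum of its class (\<open>lower_order_le_iff\<close>,
  \<open>le_upper_order_iff\<close>). A surjection with adjoints on both sides preserves all meets and joins
  and carries completeness over to its image (\<open>complete_lattice_hom_if_adjoints\<close>). Completeness of
  the cyclic Dyer lattice itself comes from transitive closures of unions of inversion sets
  (\<open>CDyer_sup_exists\<close>). Finiteness holds because the inversions of a \<open>312\<close>-avoiding order that start
  at \<open>a\<close> stop before \<open>a + n\<close> or never (\<open>finite_312_avoiding\<close>).
\<close>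


section \<open>Surjections between complete lattices with adjoints on both sides\<close>

lemma (in partial_order) complete_lattice_if_sups:
  assumes sups: "\<And>A. A \<subseteq> carrier L \<Longrightarrow> \<exists>s. least L s (Upper L A)"
  shows "complete_lattice L"
proof (rule complete_latticeI)
  fix A assume A: "A \<subseteq> carrier L"
  show "\<exists>s. least L s (Upper L A)" using sups[OF A] .
  obtain s where s: "least L s (Upper L (Lower L A))" using sups[of "Lower L A"] by auto
  have "greatest L s (Lower L A)"
  proof (rule greatest_LowerI)
    show "s \<sqsubseteq> x" if "x \<in> A" for x
      using s that A by (intro least_le[OF s] Upper_memI) auto
    show "y \<sqsubseteq> s" if "y \<in> Lower L A" for y
      using least_Upper_above[OF s that] by simp
  qed (use s A in auto)
  then show "\<exists>i. greatest L i (Lower L A)" ..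
qed

lemma (in partial_order) sup_eqI:
  assumes "least L s (Upper L A)"
  shows "\<Squnion>A = s"
  unfolding sup_def by (rule some_equality) (use assms least_unique in auto)

lemma (in partial_order) inf_eqI:
  assumes "greatest L s (Lower L A)"
  shows "\<Sqinter>A = s"
  unfolding inf_def by (rule some_equality) (use assms greatest_unique in auto)

text \<open>A map with a lower adjoint \<open>e\<close> preserves all meets and a map with an upper adjoint \<open>g\<close>
  preserves all joins. Surjectivity makes every subset of \<open>M\<close> the image of a subset of \<open>L\<close>, so that
  completeness is inherited and need not be checked for \<open>M\<close> separately.\<close>

lemma complete_lattice_hom_if_adjoints:
  fixes L :: "'a gorder" and M :: "'b gorder"
  assumes L: "complete_lattice L" and M: "partial_order M"
    and f: "f ` carrier L = carrier M"
    and e: "\<And>y. y \<in> carrier M \<Longrightarrow> e y \<in> carrier L"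
    and g: "\<And>y. y \<in> carrier M \<Longrightarrow> g y \<in> carrier L"
    and adj_e: "\<And>x y. x \<in> carrier L \<Longrightarrow> y \<in> carrier M \<Longrightarrow> y \<sqsubseteq>\<^bsub>M\<^esub> f x \<longleftrightarrow> e y \<sqsubseteq>\<^bsub>L\<^esub> x"
    and adj_g: "\<And>x y. x \<in> carrier L \<Longrightarrow> y \<in> carrier M \<Longrightarrow> f x \<sqsubseteq>\<^bsub>M\<^esub> y \<longleftrightarrow> x \<sqsubseteq>\<^bsub>L\<^esub> g y"
  shows "complete_lattice M" and "complete_lattice_hom L M f"
proof -
  interpret L: complete_lattice L by fact
  interpret M: partial_order M by fact
  have fc: "f x \<in> carrier M" if "x \<in> carrier L" for x
    using f that by blast
  have sup: "least M (f (\<Squnion>\<^bsub>L\<^esub> A)) (Upper M (f ` A))" if A: "A \<subseteq> carrier L" for A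
  proof (rule least_UpperI)
    have S: "least L (\<Squnion>\<^bsub>L\<^esub> A) (Upper L A)"
      using L.sup_exists[OF A] L.sup_eqI by metis
    have Sc: "\<Squnion>\<^bsub>L\<^esub> A \<in> carrier L" using S by auto
    show "y \<sqsubseteq>\<^bsub>M\<^esub> f (\<Squnion>\<^bsub>L\<^esub> A)" if "y \<in> f ` A" for y
    proof -
      obtain a where a: "a \<in> A" "y = f a" using \<open>y \<in> f ` A\<close> by auto
      have "a \<sqsubseteq>\<^bsub>L\<^esub> \<Squnion>\<^bsub>L\<^esub> A" using least_Upper_above[OF S a(1) A] .
      moreover have "a \<sqsubseteq>\<^bsub>L\<^esub> g (f (\<Squnion>\<^bsub>L\<^esub> A))"
        using adj_g[OF Sc fc[OF Sc]] L.le_trans[OF calculation] M.le_refl[OF fc[OF Sc]] a A Sc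
          g[OF fc[OF Sc]] by blast
      ultimately show ?thesis using adj_g[of a "f (\<Squnion>\<^bsub>L\<^esub> A)"] a A fc[OF Sc] by blast
    qed
    show "f (\<Squnion>\<^bsub>L\<^esub> A) \<sqsubseteq>\<^bsub>M\<^esub> y" if y: "y \<in> Upper M (f ` A)" for y
    proof -
      have yc: "y \<in> carrier M" using y by (auto simp: Upper_def)
      have "a \<sqsubseteq>\<^bsub>L\<^esub> g y" if "a \<in> A" for a
        using y that A adj_g[of a y] yc fc by (auto simp: Upper_def)
      then have "\<Squnion>\<^bsub>L\<^esub> A \<sqsubseteq>\<^bsub>L\<^esub> g y"
        using g[OF yc] by (intro least_le[OF S] Upper_memI) auto
      then show ?thesis using adj_g[OF Sc yc] by simp
    qed
    show "f ` A \<subseteq> carrier M" using A fc by auto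
    show "f (\<Squnion>\<^bsub>L\<^esub> A) \<in> carrier M" using fc[OF Sc] .
  qed
  have inf: "greatest M (f (\<Sqinter>\<^bsub>L\<^esub> A)) (Lower M (f ` A))" if A: "A \<subseteq> carrier L" for A
  proof (rule greatest_LowerI)
    have S: "greatest L (\<Sqinter>\<^bsub>L\<^esub> A) (Lower L A)"
      using L.inf_exists[OF A] L.inf_eqI by metis
    have Sc: "\<Sqinter>\<^bsub>L\<^esub> A \<in> carrier L" using S by auto
    show "f (\<Sqinter>\<^bsub>L\<^esub> A) \<sqsubseteq>\<^bsub>M\<^esub> y" if "y \<in> f ` A" for y
    proof -
      obtain a where a: "a \<in> A" "y = f a" using \<open>y \<in> f ` A\<close> by auto
      have "\<Sqinter>\<^bsub>L\<^esub> A \<sqsubseteq>\<^bsub>L\<^esub> a" using greatest_Lower_below[OF S a(1) A] .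
      moreover have "e (f (\<Sqinter>\<^bsub>L\<^esub> A)) \<sqsubseteq>\<^bsub>L\<^esub> \<Sqinter>\<^bsub>L\<^esub> A"
        using adj_e[OF Sc fc[OF Sc]] M.le_refl[OF fc[OF Sc]] by blast
      ultimately have "e (f (\<Sqinter>\<^bsub>L\<^esub> A)) \<sqsubseteq>\<^bsub>L\<^esub> a"
        using L.le_trans[of "e (f (\<Sqinter>\<^bsub>L\<^esub> A))" "\<Sqinter>\<^bsub>L\<^esub> A" a] e[OF fc[OF Sc]] Sc a A by blast
      then show ?thesis using adj_e[of a "f (\<Sqinter>\<^bsub>L\<^esub> A)"] a A fc[OF Sc] by blast
    qed
    show "y \<sqsubseteq>\<^bsub>M\<^esub> f (\<Sqinter>\<^bsub>L\<^esub> A)" if y: "y \<in> Lower M (f ` A)" for y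
    proof -
      have yc: "y \<in> carrier M" using y by (auto simp: Lower_def)
      have "e y \<sqsubseteq>\<^bsub>L\<^esub> a" if "a \<in> A" for a
        using y that A adj_e[of a y] yc fc by (auto simp: Lower_def)
      then have "e y \<sqsubseteq>\<^bsub>L\<^esub> \<Sqinter>\<^bsub>L\<^esub> A"
        using e[OF yc] by (intro greatest_le[OF S] Lower_memI) auto
      then show ?thesis using adj_e[OF Sc yc] by simp
    qed
    show "f ` A \<subseteq> carrier M" using A fc by auto
    show "f (\<Sqinter>\<^bsub>L\<^esub> A) \<in> carrier M" using fc[OF Sc] .
  qed
  show "complete_lattice M"
  proof (rule M.complete_lattice_if_sups)
    fix B assume "B \<subseteq> carrier M"
    then obtain A where "A \<subseteq> carrier L" "B = f ` A"
      using f by (metis subset_image_iff)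
    then show "\<exists>s. least M s (Upper M B)" using sup by blast
  qed
  then show "complete_lattice_hom L M f"
    unfolding complete_lattice_hom_def sup_pres_def inf_pres_def
    using L f M.sup_eqI[OF sup] M.inf_eqI[OF inf] by simp
qed


section \<open>The complete lattice of translation-invariant total orders\<close>

lemma linear_order_on_UNIV_iff:
  "linear_order_on UNIV r \<longleftrightarrow>
     (\<forall>a. (a, a) \<in> r) \<and> (\<forall>a b c. (a, b) \<in> r \<longrightarrow> (b, c) \<in> r \<longrightarrow> (a, c) \<in> r) \<and>
     (\<forall>a b. (a, b) \<in> r \<longrightarrow> (b, a) \<in> r \<longrightarrow> a = b) \<and> (\<forall>a b. (a, b) \<in> r \<or> (b, a) \<in> r)"
  unfolding linear_order_on_def partial_order_on_def preorder_on_def refl_on_def trans_def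
    antisym_def total_on_def
  by (auto; metis)

lemma linear_orderD:
  assumes "linear_order_on UNIV r"
  shows linear_order_refl: "(a, a) \<in> r"
    and linear_order_trans: "(a, b) \<in> r \<Longrightarrow> (b, c) \<in> r \<Longrightarrow> (a, c) \<in> r"
    and linear_order_antisym: "(a, b) \<in> r \<Longrightarrow> (b, a) \<in> r \<Longrightarrow> a = b"
    and linear_order_total: "(a, b) \<in> r \<or> (b, a) \<in> r"
  using assms unfolding linear_order_on_UNIV_iff by blast+

lemma linear_order_subset_eq:
  assumes "linear_order_on UNIV r" "linear_order_on UNIV s" "r \<subseteq> s"
  shows "r = s"
proof -
  have "(a, b) \<in> r" if "(a, b) \<in> s" for a b
    using that assms(3) linear_order_total[OF assms(1), of a b] linear_order_antisym[OF assms(2), of a b]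
      linear_order_refl[OF assms(1)] by blast
  then show ?thesis using assms(3) by auto
qed

definition inversions :: "int rel \<Rightarrow> int rel" where
  "inversions r = {(a, b). a < b \<and> (b, a) \<in> r}"

definition order_of_inversions :: "int rel \<Rightarrow> int rel" where
  "order_of_inversions I = {(a, b). a = b \<or> a < b \<and> (a, b) \<notin> I \<or> b < a \<and> (b, a) \<in> I}"

text \<open>Transitivity of the order amounts to both the set of inversions and its
  complement being closed under composition.\<close>

lemma linear_order_of_inversions:
  assumes trans: "\<And>a b c. (a, b) \<in> I \<Longrightarrow> (b, c) \<in> I \<Longrightarrow> (a, c) \<in> I"
    and cotrans: "\<And>a b c. (a, c) \<in> I \<Longrightarrow> a < b \<Longrightarrow> b < c \<Longrightarrow> (a, b) \<in> I \<or> (b, c) \<in> I"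
  shows "linear_order_on UNIV (order_of_inversions I)"
  unfolding linear_order_on_UNIV_iff
proof (intro conjI allI impI)
  fix a b c
  assume ab: "(a, b) \<in> order_of_inversions I" and bc: "(b, c) \<in> order_of_inversions I"
  consider "a = b \<or> b = c" | "a = c" | "a < b" "b < c" | "a < b" "c < b" "a < c"
    | "a < b" "c < b" "c < a" | "b < a" "b < c" "a < c" | "b < a" "b < c" "c < a" | "b < a" "c < b"
    by linarith
  then show "(a, c) \<in> order_of_inversions I"
  proof cases
    case 3 then show ?thesis
      using ab bc cotrans[of a c b] by (auto simp: order_of_inversions_def)
  next
    case 4 then show ?thesis
      using ab bc trans[of a c b] by (auto simp: order_of_inversions_def)
  next
    case 5 then show ?thesis
      using ab bc cotrans[of c b a] by (auto simp: order_of_inversions_def)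
  next
    case 6 then show ?thesis
      using ab bc trans[of b a c] by (auto simp: order_of_inversions_def)
  next
    case 7 then show ?thesis
      using ab bc cotrans[of b a c] by (auto simp: order_of_inversions_def)
  next
    case 8 then show ?thesis
      using ab bc trans[of c b a] by (auto simp: order_of_inversions_def)
  qed (use ab bc in \<open>auto simp: order_of_inversions_def\<close>)
qed (auto simp: order_of_inversions_def)

lemma inversions_order_of_inversions:
  assumes "\<And>a b. (a, b) \<in> I \<Longrightarrow> a < b"
  shows "inversions (order_of_inversions I) = I"
  using assms by (auto simp: inversions_def order_of_inversions_def)

lemma inversions_trans:
  assumes "linear_order_on UNIV r" "(a, b) \<in> inversions r" "(b, c) \<in> inversions r"
  shows "(a, c) \<in> inversions r"
  using assms linear_order_trans[OF assms(1), of c b a] unfolding inversions_def by auto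

lemma inversions_cotrans:
  assumes "linear_order_on UNIV r" "(a, c) \<in> inversions r" "a < b" "b < c"
  shows "(a, b) \<in> inversions r \<or> (b, c) \<in> inversions r"
  using assms linear_order_total[OF assms(1), of b a] linear_order_trans[OF assms(1), of c a b]
  unfolding inversions_def by auto

lemma eq_if_inversions_eq:
  assumes r: "linear_order_on UNIV r" and s: "linear_order_on UNIV s"
    and eq: "inversions r = inversions s"
  shows "r = s"
proof (rule linear_order_subset_eq[OF r s], clarify)
  fix a b assume ab: "(a, b) \<in> r"
  have eq': "(y, x) \<in> r \<longleftrightarrow> (y, x) \<in> s" if "x < y" for x y
    using eq that by (auto simp: inversions_def set_eq_iff)
  consider "a = b" | "b < a" | "a < b" by linarith
  then show "(a, b) \<in> s"
    using ab eq' linear_order_refl[OF s] linear_order_total[OF s, of a b] linear_order_antisym[OF r ab]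
    by cases auto
qed

lemma TITO_linear: "r \<in> TITO n \<Longrightarrow> linear_order_on UNIV r"
  by (simp add: TITO_def)

lemma translate_iff:
  fixes n k :: int
  assumes "\<And>a b. (a, b) \<in> R \<longleftrightarrow> (a + n, b + n) \<in> R"
  shows "(a, b) \<in> R \<longleftrightarrow> (a + k * n, b + k * n) \<in> R"
proof (induction k rule: int_induct[of _ 0])
  case (step1 i) then show ?case
    using assms[of "a + i * n" "b + i * n"] by (simp add: algebra_simps)
next
  case (step2 i) then show ?case
    using assms[of "a + (i - 1) * n" "b + (i - 1) * n"] by (simp add: algebra_simps)
qed simp

lemma TITO_translate:
  assumes "r \<in> TITO n"
  shows "(a, b) \<in> r \<longleftrightarrow> (a + k * n, b + k * n) \<in> r"
  by (rule translate_iff) (use assms in \<open>simp add: TITO_def\<close>)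

lemma reflection_index_in_Inv_iff:
  assumes r: "r \<in> TITO n" and "a < b"
  shows "reflection_index n a b \<in> Inv n r \<longleftrightarrow> (b, a) \<in> r"
proof
  assume "reflection_index n a b \<in> Inv n r"
  then obtain c d where cd: "reflection_index n a b = reflection_index n c d" "c < d" "(d, c) \<in> r"
    by (auto simp: Inv_def)
  have "(a, b) \<in> reflection_index n a b"
    by (auto simp: reflection_index_def translation_equiv_def intro: exI[of _ 0])
  with cd(1) obtain k where "a = c + k * n" "b = d + k * n"
    by (auto simp: reflection_index_def translation_equiv_def)
  with cd(3) show "(b, a) \<in> r" using TITO_translate[OF r] by metis
qed (use assms in \<open>auto simp: Inv_def\<close>)

text \<open>Passing to classes of pairs modulo translation loses nothing for invariant orders.\<close>

lemma Inv_subset_iff: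
  assumes r: "r \<in> TITO n" and s: "s \<in> TITO n"
  shows "Inv n r \<subseteq> Inv n s \<longleftrightarrow> inversions r \<subseteq> inversions s"
proof
  assume le: "Inv n r \<subseteq> Inv n s"
  show "inversions r \<subseteq> inversions s"
    using le reflection_index_in_Inv_iff[OF r] reflection_index_in_Inv_iff[OF s]
    unfolding inversions_def by blast
next
  assume "inversions r \<subseteq> inversions s"
  then show "Inv n r \<subseteq> Inv n s"
    unfolding Inv_def inversions_def by blast
qed

lemma carrier_CDyer [simp]: "carrier (CDyer n) = TITO n"
  by (simp add: CDyer_def)

lemma le_CDyer_iff:
  "r \<in> TITO n \<Longrightarrow> s \<in> TITO n \<Longrightarrow> r \<sqsubseteq>\<^bsub>CDyer n\<^esub> s \<longleftrightarrow> inversions r \<subseteq> inversions s"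
  by (simp add: CDyer_def Inv_subset_iff)

lemma CDyer_le_antisym:
  "r \<sqsubseteq>\<^bsub>CDyer n\<^esub> s \<Longrightarrow> s \<sqsubseteq>\<^bsub>CDyer n\<^esub> r \<Longrightarrow> r \<in> TITO n \<Longrightarrow> s \<in> TITO n \<Longrightarrow> r = s"
  by (simp add: le_CDyer_iff eq_if_inversions_eq TITO_linear)

lemma CDyer_subset_partial_order:
  assumes "S \<subseteq> TITO n"
  shows "partial_order ((CDyer n)\<lparr>carrier := S\<rparr>)"
  by standard
    (use assms CDyer_le_antisym[where n = n] in \<open>auto simp: CDyer_def subset_iff\<close>)

lemma CDyer_partial_order: "partial_order (CDyer n)"
  using CDyer_subset_partial_order[of "TITO n" n] by (simp add: CDyer_def)

text \<open>The join of a family has the transitive closure of the union of the sets of inversions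
  as its set of inversions. The closure stays cotransitive: a point between the ends of a chain of
  inversions either lies on the chain or splits one of its links.\<close>

lemma CDyer_sup_exists:
  assumes A: "A \<subseteq> TITO n"
  shows "\<exists>s. least (CDyer n) s (Upper (CDyer n) A)"
proof -
  define U where "U = (\<Union>r\<in>A. inversions r)"
  define s where "s = order_of_inversions (U\<^sup>+)"
  have lin: "linear_order_on UNIV r" if "r \<in> A" for r
    using that A TITO_linear by blast
  have lt: "a < b" if "(a, b) \<in> U\<^sup>+" for a b
    using that by induction (auto simp: U_def inversions_def)
  have cotrans_U: "(a, b) \<in> U \<or> (b, c) \<in> U" if "(a, c) \<in> U" "a < b" "b < c" for a b c
    using that inversions_cotrans[OF lin] unfolding U_def by blast
  have cotrans: "(a, b) \<in> U\<^sup>+ \<or> (b, c) \<in> U\<^sup>+" if "(a, c) \<in> U\<^sup>+" "a < b" "b < c" for a b c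
    using that
  proof (induction arbitrary: b)
    case (base c) then show ?case using cotrans_U by blast
  next
    case (step c d)
    consider "b < c" | "b = c" | "c < b" by linarith
    then show ?case
      using step cotrans_U[of c d b] by cases (auto intro: trancl_into_trancl)
  qed
  have s_lin: "linear_order_on UNIV s"
    unfolding s_def by (rule linear_order_of_inversions) (fact trancl_trans, fact cotrans)
  have inv_s: "inversions s = U\<^sup>+"
    unfolding s_def by (rule inversions_order_of_inversions) (rule lt)
  have U_shift: "(a + k * n, b + k * n) \<in> U" if ab: "(a, b) \<in> U" for a b k
  proof -
    obtain r where "r \<in> A" "(a, b) \<in> inversions r" using ab unfolding U_def by blast
    then show ?thesis
      using TITO_translate[of r n b a k] A by (auto simp: U_def inversions_def)
  qed
  have shift: "(a + k * n, b + k * n) \<in> U\<^sup>+" if "(a, b) \<in> U\<^sup>+" for a b k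
    using that by induction (auto dest: U_shift[of _ _ k] intro: trancl_into_trancl)
  have shift_iff: "(a, b) \<in> U\<^sup>+ \<longleftrightarrow> (a + n, b + n) \<in> U\<^sup>+" for a b
    using shift[of a b 1] shift[of "a + n" "b + n" "-1"] by auto
  have s: "s \<in> TITO n"
    using s_lin by (auto simp: TITO_def s_def order_of_inversions_def shift_iff[symmetric])
  have "least (CDyer n) s (Upper (CDyer n) A)"
  proof (rule least_UpperI)
    show "r \<sqsubseteq>\<^bsub>CDyer n\<^esub> s" if "r \<in> A" for r
    proof -
      have "inversions r \<subseteq> U" using that unfolding U_def by blast
      then show ?thesis using that A s inv_s by (subst le_CDyer_iff) auto
    qed
    show "s \<sqsubseteq>\<^bsub>CDyer n\<^esub> t" if t: "t \<in> Upper (CDyer n) A" for t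
    proof -
      have tT: "t \<in> TITO n" using t by (auto simp: Upper_def)
      have Ut: "U \<subseteq> inversions t"
      proof -
        have "inversions r \<subseteq> inversions t" if "r \<in> A" for r
          using t that A tT le_CDyer_iff[of r n t] by (auto simp: Upper_def)
        then show ?thesis by (auto simp: U_def)
      qed
      have "(a, b) \<in> inversions t" if "(a, b) \<in> U\<^sup>+" for a b
        using that by induction (use Ut inversions_trans[OF TITO_linear[OF tT]] in blast)+
      then show ?thesis using s tT inv_s by (auto simp: le_CDyer_iff)
    qed
  qed (use A s in auto)
  then show ?thesis ..
qed

lemma CDyer_complete_lattice: "complete_lattice (CDyer n)"
  using partial_order.complete_lattice_if_sups[OF CDyer_partial_order] CDyer_sup_exists by simp


section \<open>Descendant orders\<close>

text \<open>\<open>(u, v) \<in> D\<close> reads: \<open>u\<close> is a descendant of \<open>v\<close>.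
  The two axioms that go beyond partial orders hold for a binary tree whose nodes are numbered
  in in-order: subtrees occupy convex sets of numbers (\<open>convex\<close>), and the least common ancestor of
  two nodes is numbered between them (\<open>peak\<close>).\<close>

locale descendant_order =
  fixes D :: "int rel"
  assumes refl: "(u, u) \<in> D"
    and antisym: "(u, v) \<in> D \<Longrightarrow> (v, u) \<in> D \<Longrightarrow> u = v"
    and trans: "(u, v) \<in> D \<Longrightarrow> (v, w) \<in> D \<Longrightarrow> (u, w) \<in> D"
    and convex: "(u, v) \<in> D \<Longrightarrow> u \<le> w \<and> w \<le> v \<or> v \<le> w \<and> w \<le> u \<Longrightarrow> (w, v) \<in> D"
    and peak: "u \<le> v \<Longrightarrow> \<exists>x. u \<le> x \<and> x \<le> v \<and> (u, x) \<in> D \<and> (v, x) \<in> D"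

text \<open>A descendant precedes its ancestors in every linear extension; \<open>lower_order\<close> and \<open>upper_order\<close> decide
  the incomparable pairs as in the usual order of the integers and against it, respectively, which
  makes them the extensions with the fewest and the most inversions.\<close>

definition lower_order :: "int rel \<Rightarrow> int rel" where
  "lower_order D = {(u, v). (u, v) \<in> D \<or> u < v \<and> (v, u) \<notin> D}"

definition upper_order :: "int rel \<Rightarrow> int rel" where
  "upper_order D = {(u, v). (u, v) \<in> D \<or> v < u \<and> (v, u) \<notin> D}"

text \<open>\<open>v\<close> is the \<open>r\<close>-largest of the integers between \<open>u\<close> and \<open>v\<close>. This will turn out to be the descendant
  relation of the tree of \<open>r\<close>.\<close>

definition dominance :: "int rel \<Rightarrow> int rel" where
  "dominance r = {(u, v). \<forall>w. u \<le> w \<and> w \<le> v \<or> v \<le> w \<and> w \<le> u \<longrightarrow> (w, v) \<in> r}"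

lemma dominance_subset: "dominance r \<subseteq> r"
  by (auto simp: dominance_def)

lemma finite_has_linear_order_max:
  assumes r: "linear_order_on UNIV r" and "finite A" "A \<noteq> {}"
  shows "\<exists>m\<in>A. \<forall>a\<in>A. (a, m) \<in> r"
  using assms(2,3)
proof (induction rule: finite_ne_induct)
  case (singleton x) then show ?case using linear_order_refl[OF r] by simp
next
  case (insert x A)
  then obtain m where m: "m \<in> A" "\<forall>a\<in>A. (a, m) \<in> r" by blast
  show ?case
  proof (cases "(x, m) \<in> r")
    case True then show ?thesis using m by auto
  next
    case False
    then have "(m, x) \<in> r" using linear_order_total[OF r] by blast
    then show ?thesis
      using m linear_order_trans[OF r] linear_order_refl[OF r] by (intro bexI[of _ x]) auto
  qed
qed

text \<open>The peak of \<open>u\<close> and \<open>v\<close> is the \<open>r\<close>-largest integer between them, which exists since there are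
  finitely many.\<close>

lemma descendant_order_dominance:
  assumes r: "linear_order_on UNIV r"
  shows "descendant_order (dominance r)"
proof
  show "(u, u) \<in> dominance r" for u
    using linear_order_refl[OF r] by (auto simp: dominance_def)
  show "u = v" if "(u, v) \<in> dominance r" "(v, u) \<in> dominance r" for u v
    using that dominance_subset linear_order_antisym[OF r] by blast
  show "(u, w) \<in> dominance r" if uv: "(u, v) \<in> dominance r" and vw: "(v, w) \<in> dominance r" for u v w
    unfolding dominance_def
  proof (clarify)
    fix x assume x: "u \<le> x \<and> x \<le> w \<or> w \<le> x \<and> x \<le> u"
    have "(v, w) \<in> r" using vw dominance_subset by blast
    moreover have "u \<le> x \<and> x \<le> v \<or> v \<le> x \<and> x \<le> u \<or> v \<le> x \<and> x \<le> w \<or> w \<le> x \<and> x \<le> v"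
      using x by linarith
    then have "(x, v) \<in> r \<or> (x, w) \<in> r"
      using uv vw unfolding dominance_def by blast
    ultimately show "(x, w) \<in> r" using linear_order_trans[OF r] by blast
  qed
  show "(w, v) \<in> dominance r"
    if "(u, v) \<in> dominance r" "u \<le> w \<and> w \<le> v \<or> v \<le> w \<and> w \<le> u" for u v w
    using that unfolding dominance_def by auto
  show "\<exists>x. u \<le> x \<and> x \<le> v \<and> (u, x) \<in> dominance r \<and> (v, x) \<in> dominance r"
    if uv: "u \<le> v" for u v
  proof -
    obtain m where m: "m \<in> {u..v}" "\<forall>a\<in>{u..v}. (a, m) \<in> r"
      using finite_has_linear_order_max[OF r, of "{u..v}"] uv by auto
    then show ?thesis by (intro exI[of _ m]) (auto simp: dominance_def)
  qed
qed

context descendant_order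
begin

text \<open>In each mixed case of transitivity the undesired outcome puts an integer between a node and its
  descendant, and convexity then contradicts one of the assumed non-relations.\<close>

lemma lower_order_linear: "linear_order_on UNIV (lower_order D)"
  unfolding linear_order_on_UNIV_iff
proof (intro conjI allI impI)
  fix a b c
  assume ab: "(a, b) \<in> lower_order D" and bc: "(b, c) \<in> lower_order D"
  then consider "(a, b) \<in> D" "(b, c) \<in> D" | "(a, b) \<in> D" "b < c" "(c, b) \<notin> D"
    | "a < b" "(b, a) \<notin> D" "(b, c) \<in> D" | "a < b" "(b, a) \<notin> D" "b < c" "(c, b) \<notin> D"
    by (auto simp: lower_order_def)
  then have "(a, c) \<in> D \<or> a < c \<and> (c, a) \<notin> D"
  proof cases
    case 1 then show ?thesis using trans by blast
  next
    case 2 then show ?thesis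
      using trans[of c a b] convex[of a b c] by linarith
  next
    case 3 then show ?thesis
      using trans[of b c a] convex[of b c a] by linarith
  next
    case 4 then show ?thesis
      using convex[of c a b] by linarith
  qed
  then show "(a, c) \<in> lower_order D" by (simp add: lower_order_def)
qed (use refl antisym in \<open>force simp: lower_order_def\<close>)+

lemma upper_order_linear: "linear_order_on UNIV (upper_order D)"
  unfolding linear_order_on_UNIV_iff
proof (intro conjI allI impI)
  fix a b c
  assume ab: "(a, b) \<in> upper_order D" and bc: "(b, c) \<in> upper_order D"
  then consider "(a, b) \<in> D" "(b, c) \<in> D" | "(a, b) \<in> D" "c < b" "(c, b) \<notin> D"
    | "b < a" "(b, a) \<notin> D" "(b, c) \<in> D" | "b < a" "(b, a) \<notin> D" "c < b" "(c, b) \<notin> D"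
    by (auto simp: upper_order_def)
  then have "(a, c) \<in> D \<or> c < a \<and> (c, a) \<notin> D"
  proof cases
    case 1 then show ?thesis using trans by blast
  next
    case 2 then show ?thesis
      using trans[of c a b] convex[of a b c] by linarith
  next
    case 3 then show ?thesis
      using trans[of b c a] convex[of b c a] by linarith
  next
    case 4 then show ?thesis
      using convex[of c a b] by linarith
  qed
  then show "(a, c) \<in> upper_order D" by (simp add: upper_order_def)
qed (use refl antisym in \<open>force simp: upper_order_def\<close>)+

lemma inversions_lower_order: "inversions (lower_order D) = {(a, b). a < b \<and> (b, a) \<in> D}"
  by (auto simp: inversions_def lower_order_def)

lemma inversions_upper_order: "inversions (upper_order D) = {(a, b). a < b \<and> (a, b) \<notin> D}"
  using antisym by (auto simp: inversions_def upper_order_def)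

text \<open>This is why the fibres of \<open>dominance\<close> are intervals.\<close>

lemma linear_extension_iff_between:
  assumes r: "linear_order_on UNIV r"
  shows "D \<subseteq> r \<longleftrightarrow>
    inversions (lower_order D) \<subseteq> inversions r \<and> inversions r \<subseteq> inversions (upper_order D)"
proof
  assume D: "D \<subseteq> r"
  show "inversions (lower_order D) \<subseteq> inversions r \<and> inversions r \<subseteq> inversions (upper_order D)"
    unfolding inversions_lower_order inversions_upper_order
    using D linear_order_antisym[OF r] by (auto simp: inversions_def)
next
  assume le: "inversions (lower_order D) \<subseteq> inversions r \<and> inversions r \<subseteq> inversions (upper_order D)"
  show "D \<subseteq> r"
  proof clarify
    fix a b assume ab: "(a, b) \<in> D"
    consider "a = b" | "b < a" | "a < b" by linarith
    then show "(a, b) \<in> r"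
    proof cases
      case 1 then show ?thesis using linear_order_refl[OF r] by simp
    next
      case 2
      then have "(b, a) \<in> inversions (lower_order D)" using ab by (simp add: inversions_lower_order)
      then show ?thesis using le by (auto simp: inversions_def)
    next
      case 3
      then have "(a, b) \<notin> inversions (upper_order D)" using ab by (simp add: inversions_upper_order)
      then have "(b, a) \<notin> r" using 3 le by (auto simp: inversions_def)
      then show ?thesis using linear_order_total[OF r, of a b] by blast
    qed
  qed
qed

text \<open>A linear extension determines the descendant order from which it comes: if \<open>v\<close> dominates \<open>u\<close>, it
  cannot precede the peak of the two, hence is that peak.\<close>

lemma dominance_eq:
  assumes r: "linear_order_on UNIV r" and D: "D \<subseteq> r"
  shows "dominance r = D"
proof (intro equalityI subrelI)
  fix u v assume "(u, v) \<in> D"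
  then show "(u, v) \<in> dominance r"
    using convex D unfolding dominance_def by blast
next
  fix u v assume uv: "(u, v) \<in> dominance r"
  obtain x where x: "u \<le> x \<and> x \<le> v \<or> v \<le> x \<and> x \<le> u" "(u, x) \<in> D" "(v, x) \<in> D"
    using peak[of u v] peak[of v u] by (meson linear)
  have "x = v"
    using linear_order_antisym[OF r, of x v] uv x D unfolding dominance_def by blast
  then show "(u, v) \<in> D" using x by simp
qed

lemma dominance_lower_order: "dominance (lower_order D) = D"
  by (rule dominance_eq[OF lower_order_linear]) (auto simp: lower_order_def)

lemma dominance_upper_order: "dominance (upper_order D) = D"
  by (rule dominance_eq[OF upper_order_linear]) (auto simp: upper_order_def)

lemma lower_order_avoids_312: "avoids_312 (lower_order D)"
  unfolding avoids_312_def
proof clarify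
  fix a b c
  assume abc: "a < b" "b < c" and ca: "(c, a) \<in> lower_order D" and ab: "(a, b) \<in> lower_order D"
  have "(b, a) \<in> D" using ca abc convex[of c a b] by (auto simp: lower_order_def)
  then show False using ab abc antisym[of a b] by (auto simp: lower_order_def)
qed

end

text \<open>If \<open>b < a\<close> and \<open>a\<close> comes before \<open>b\<close>, then an integer strictly between them that came after \<open>b\<close>
  would complete a pattern \<open>312\<close>; so every inversion is already forced by \<open>dominance\<close>.\<close>

lemma eq_lower_order_if_avoids_312:
  assumes r: "linear_order_on UNIV r" and av: "avoids_312 r"
  shows "lower_order (dominance r) = r"
proof (rule linear_order_subset_eq[symmetric, OF r], rule descendant_order.lower_order_linear)
  show "descendant_order (dominance r)" using r by (rule descendant_order_dominance)
  show "r \<subseteq> lower_order (dominance r)"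
  proof clarify
    fix a b assume ab: "(a, b) \<in> r"
    have "(a, b) \<in> dominance r" if ba: "b < a"
      unfolding dominance_def
    proof clarify
      fix w assume "a \<le> w \<and> w \<le> b \<or> b \<le> w \<and> w \<le> a"
      then consider "w = a" | "w = b" | "b < w" "w < a" using ba by linarith
      then show "(w, b) \<in> r"
      proof cases
        case 3 then show ?thesis
          using av ab linear_order_total[OF r, of w b] unfolding avoids_312_def by blast
      qed (use ab linear_order_refl[OF r] in auto)
    qed
    moreover have "(b, a) \<notin> dominance r" if "a < b"
      using that ab dominance_subset linear_order_antisym[OF r] by fastforce
    moreover have "(a, a) \<in> dominance r"
      using linear_order_refl[OF r] by (auto simp: dominance_def)
    ultimately show "(a, b) \<in> lower_order (dominance r)"
      unfolding lower_order_def by (cases a b rule: linorder_cases) auto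
  qed
qed

lemma inversions_lower_order_mono:
  assumes r: "linear_order_on UNIV r" and s: "linear_order_on UNIV s"
    and le: "inversions r \<subseteq> inversions s"
  shows "inversions (lower_order (dominance r)) \<subseteq> inversions (lower_order (dominance s))"
proof -
  have "(b, a) \<in> dominance s" if ab: "a < b" "(b, a) \<in> dominance r" for a b
    unfolding dominance_def
  proof clarify
    fix w assume w: "b \<le> w \<and> w \<le> a \<or> a \<le> w \<and> w \<le> b"
    then have "(w, a) \<in> r" using ab unfolding dominance_def by blast
    then show "(w, a) \<in> s"
      using w ab subsetD[OF le, of "(a, w)"] linear_order_refl[OF s]
      by (cases "w = a") (auto simp: inversions_def)
  qed
  then show ?thesis
    using descendant_order.inversions_lower_order[OF descendant_order_dominance] r s by auto
qed

lemma inversions_upper_order_mono: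
  assumes r: "linear_order_on UNIV r" and s: "linear_order_on UNIV s"
    and le: "inversions r \<subseteq> inversions s"
  shows "inversions (upper_order (dominance r)) \<subseteq> inversions (upper_order (dominance s))"
proof -
  have "(a, b) \<in> dominance r" if ab: "a < b" "(a, b) \<in> dominance s" for a b
    unfolding dominance_def
  proof clarify
    fix w assume w: "a \<le> w \<and> w \<le> b \<or> b \<le> w \<and> w \<le> a"
    then have wb: "(w, b) \<in> s" using ab unfolding dominance_def by blast
    then have "(b, w) \<notin> s" if "w \<noteq> b" using that linear_order_antisym[OF s] by blast
    then show "(w, b) \<in> r"
      using w ab subsetD[OF le, of "(w, b)"] linear_order_refl[OF r] linear_order_total[OF r, of w b]
      by (cases "w = b") (auto simp: inversions_def)
  qed
  then show ?thesis
    using descendant_order.inversions_upper_order[OF descendant_order_dominance] r s by auto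
qed

lemma dominance_translate:
  assumes r: "r \<in> TITO n"
  shows "(u, v) \<in> dominance r \<longleftrightarrow> (u + k * n, v + k * n) \<in> dominance r"
proof
  assume uv: "(u, v) \<in> dominance r"
  show "(u + k * n, v + k * n) \<in> dominance r"
    unfolding dominance_def
  proof clarify
    fix w assume "u + k * n \<le> w \<and> w \<le> v + k * n \<or> v + k * n \<le> w \<and> w \<le> u + k * n"
    then have "u \<le> w - k * n \<and> w - k * n \<le> v \<or> v \<le> w - k * n \<and> w - k * n \<le> u" by linarith
    then have "(w - k * n, v) \<in> r" using uv unfolding dominance_def by blast
    then show "(w, v + k * n) \<in> r" using TITO_translate[OF r, of "w - k * n" v k] by simp
  qed
next
  assume uv: "(u + k * n, v + k * n) \<in> dominance r"
  show "(u, v) \<in> dominance r"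
    unfolding dominance_def
  proof clarify
    fix w assume "u \<le> w \<and> w \<le> v \<or> v \<le> w \<and> w \<le> u"
    then have "u + k * n \<le> w + k * n \<and> w + k * n \<le> v + k * n
      \<or> v + k * n \<le> w + k * n \<and> w + k * n \<le> u + k * n" by linarith
    then have "(w + k * n, v + k * n) \<in> r" using uv unfolding dominance_def by blast
    then show "(w, v) \<in> r" using TITO_translate[OF r, of w v k] by simp
  qed
qed

lemma (in descendant_order)
  assumes "\<And>u v. (u, v) \<in> D \<longleftrightarrow> (u + n, v + n) \<in> D"
  shows lower_order_TITO: "lower_order D \<in> TITO n"
    and upper_order_TITO: "upper_order D \<in> TITO n"
  using lower_order_linear upper_order_linear assms[symmetric]
  by (auto simp: TITO_def lower_order_def upper_order_def)


section \<open>The two projections of the cyclic Dyer lattice\<close>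

lemma TITO_dominance: "r \<in> TITO n \<Longrightarrow> descendant_order (dominance r)"
  by (simp add: TITO_linear descendant_order_dominance)

lemma lower_dominance_TITO: "r \<in> TITO n \<Longrightarrow> lower_order (dominance r) \<in> TITO n"
  using descendant_order.lower_order_TITO[OF TITO_dominance] dominance_translate[of r n _ _ 1]
  by simp

lemma upper_dominance_TITO: "r \<in> TITO n \<Longrightarrow> upper_order (dominance r) \<in> TITO n"
  using descendant_order.upper_order_TITO[OF TITO_dominance] dominance_translate[of r n _ _ 1]
  by simp

text \<open>The projection \<open>r \<mapsto> lower_order (dominance r)\<close> is right adjoint to the inclusion of its image:
  it yields the largest element of the image below \<open>r\<close>.\<close>

lemma lower_order_le_iff:
  assumes t: "t \<in> TITO n" and r: "r \<in> TITO n"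
  shows "lower_order (dominance t) \<sqsubseteq>\<^bsub>CDyer n\<^esub> lower_order (dominance r) \<longleftrightarrow>
    lower_order (dominance t) \<sqsubseteq>\<^bsub>CDyer n\<^esub> r"
proof -
  interpret descendant_order "dominance r" using TITO_dominance[OF r] .
  interpret t: descendant_order "dominance t" using TITO_dominance[OF t] .
  have "inversions (lower_order (dominance r)) \<subseteq> inversions r"
    using linear_extension_iff_between[OF TITO_linear[OF r]] dominance_subset by blast
  moreover have "inversions (lower_order (dominance t)) \<subseteq> inversions (lower_order (dominance r))"
    if "inversions (lower_order (dominance t)) \<subseteq> inversions r"
    using inversions_lower_order_mono[OF t.lower_order_linear TITO_linear[OF r] that]
    by (simp add: t.dominance_lower_order)
  ultimately show ?thesis
    using t r lower_dominance_TITO by (auto simp: le_CDyer_iff)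
qed

text \<open>The lower projection is also a left adjoint. Its right adjoint is the upper projection: both have
  the same fibres, are monotone, and enclose the identity.\<close>

lemma le_upper_order_iff:
  assumes t: "t \<in> TITO n" and r: "r \<in> TITO n"
  shows "lower_order (dominance r) \<sqsubseteq>\<^bsub>CDyer n\<^esub> lower_order (dominance t) \<longleftrightarrow>
    r \<sqsubseteq>\<^bsub>CDyer n\<^esub> upper_order (dominance t)"
proof -
  interpret descendant_order "dominance r" using TITO_dominance[OF r] .
  interpret t: descendant_order "dominance t" using TITO_dominance[OF t] .
  have "inversions r \<subseteq> inversions (upper_order (dominance r))"
    using linear_extension_iff_between[OF TITO_linear[OF r]] dominance_subset by blast
  moreover have "inversions (upper_order (dominance r)) \<subseteq> inversions (upper_order (dominance t))"
    if "inversions (lower_order (dominance r)) \<subseteq> inversions (lower_order (dominance t))"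
    using inversions_upper_order_mono[OF lower_order_linear t.lower_order_linear that]
    by (simp add: dominance_lower_order t.dominance_lower_order)
  moreover have "inversions (lower_order (dominance r)) \<subseteq> inversions (lower_order (dominance t))"
    if "inversions r \<subseteq> inversions (upper_order (dominance t))"
    using inversions_lower_order_mono[OF TITO_linear[OF r] t.upper_order_linear that]
    by (simp add: t.dominance_upper_order)
  ultimately show ?thesis
    using t r lower_dominance_TITO upper_dominance_TITO by (auto simp: le_CDyer_iff)
qed

lemma dominance_class_is_interval:
  assumes r: "r \<in> TITO n"
  shows "{s \<in> TITO n. dominance s = dominance r} =
    \<lbrace>lower_order (dominance r)..upper_order (dominance r)\<rbrace>\<^bsub>CDyer n\<^esub>"
proof -
  interpret descendant_order "dominance r" using TITO_dominance[OF r] .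
  have "dominance s = dominance r \<longleftrightarrow> lower_order (dominance r) \<sqsubseteq>\<^bsub>CDyer n\<^esub> s \<and>
    s \<sqsubseteq>\<^bsub>CDyer n\<^esub> upper_order (dominance r)" if s: "s \<in> TITO n" for s
  proof -
    have "dominance s = dominance r \<longleftrightarrow> dominance r \<subseteq> s"
      using dominance_eq[OF TITO_linear[OF s]] dominance_subset[of s] by blast
    then show ?thesis
      using linear_extension_iff_between[OF TITO_linear[OF s]] r s lower_dominance_TITO
        upper_dominance_TITO by (simp add: le_CDyer_iff)
  qed
  then show ?thesis by (auto simp: at_least_at_most_def)
qed

lemma lower_order_le_upper_order:
  assumes r: "r \<in> TITO n"
  shows "lower_order (dominance r) \<sqsubseteq>\<^bsub>CDyer n\<^esub> upper_order (dominance r)"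
  using le_upper_order_iff[OF r lower_dominance_TITO[OF r]]
    descendant_order.dominance_lower_order[OF TITO_dominance[OF r]]
    le_CDyer_iff[OF lower_dominance_TITO[OF r] lower_dominance_TITO[OF r]] by simp


section \<open>Finiteness of the cyclic Tamari lattice\<close>

text \<open>If \<open>r\<close> avoids \<open>312\<close>, the inversions \<open>(a, c)\<close> with fixed \<open>a\<close> form an initial segment of the integers
  above \<open>a\<close>. Once this segment reaches \<open>a + n\<close>, translation and transitivity extend it to all
  multiples, hence to all integers above \<open>a\<close>. So \<open>r\<close> is determined by its inversions in a finite box.\<close>

lemma finite_312_avoiding:
  assumes n: "n \<ge> (1::int)"
  shows "finite {r \<in> TITO n. avoids_312 r}"
proof (rule finite_imageD)
  \<comment> \<open>Second entries will be capped at \<open>a mod n + n\<close>, which is below \<open>2 * n\<close>.\<close>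
  define box where "box = {0..<n} \<times> {0..2 * n}"
  define trace where "trace r = inversions r \<inter> box" for r
  have "finite box" by (simp add: box_def)
  then show "finite (trace ` {r \<in> TITO n. avoids_312 r})"
    by (rule finite_subset[rotated, OF finite_Pow_iff[THEN iffD2]]) (auto simp: trace_def)
  have inv_iff: "(a, c) \<in> inversions r \<longleftrightarrow> a < c \<and> (a mod n, min (a mod n + (c - a)) (a mod n + n)) \<in> trace r"
    if r: "r \<in> TITO n" and av: "avoids_312 r" for r a c
  proof -
    note lin = TITO_linear[OF r]
    have shift: "(a, c) \<in> inversions r \<longleftrightarrow> (a + k * n, c + k * n) \<in> inversions r" for a c k
      using TITO_translate[OF r, of c a k] by (auto simp: inversions_def)
    have closed: "(a, b) \<in> inversions r" if "(a, c) \<in> inversions r" "a < b" "b \<le> c" for a b c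
      using that av linear_order_total[OF lin, of a b]
      unfolding avoids_312_def inversions_def by (cases "b = c") auto
    have multiples: "(a, a + int (Suc k) * n) \<in> inversions r" if "(a, a + n) \<in> inversions r" for a k
    proof (induction k)
      case (Suc k)
      have "(a + int (Suc k) * n, a + n + int (Suc k) * n) \<in> inversions r"
        using shift[of a "a + n" "int (Suc k)"] that by simp
      then show ?case
        using inversions_trans[OF lin Suc] by (simp add: algebra_simps)
    qed (use that in simp)
    have capped: "(a, c) \<in> inversions r \<longleftrightarrow> (a, min c (a + n)) \<in> inversions r" if "a < c" for a c
    proof
      assume "(a, c) \<in> inversions r"
      then show "(a, min c (a + n)) \<in> inversions r"
        by (rule closed) (use that n in auto)
    next
      assume h: "(a, min c (a + n)) \<in> inversions r"
      show "(a, c) \<in> inversions r"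
      proof (cases "c \<le> a + n")
        case False
        have "(a, a + int (Suc (nat (c - a))) * n) \<in> inversions r"
          using h False by (intro multiples) simp
        moreover have "c \<le> a + int (Suc (nat (c - a))) * n"
        proof -
          have "c - a \<le> int (Suc (nat (c - a))) * 1" using that by simp
          also have "\<dots> \<le> int (Suc (nat (c - a))) * n" using n by (intro mult_left_mono) auto
          finally show ?thesis by simp
        qed
        ultimately show ?thesis using closed that by blast
      qed (use h in simp)
    qed
    have a: "a = a mod n + (a div n) * n" by simp
    have "0 \<le> a mod n" "a mod n < n" using n by auto
    moreover have "(a, c) \<in> inversions r \<longleftrightarrow> (a mod n, a mod n + (c - a)) \<in> inversions r"
      using shift[of "a mod n" "a mod n + (c - a)" "a div n"] a by (simp add: algebra_simps)
    ultimately show ?thesis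
      using capped[of "a mod n" "a mod n + (c - a)"] by (auto simp: trace_def box_def inversions_def)
  qed
  show "inj_on trace {r \<in> TITO n. avoids_312 r}"
  proof (rule inj_onI)
    fix r s
    assume "r \<in> {r \<in> TITO n. avoids_312 r}" "s \<in> {r \<in> TITO n. avoids_312 r}"
      and eq: "trace r = trace s"
    then have r: "r \<in> TITO n" "avoids_312 r" and s: "s \<in> TITO n" "avoids_312 s" by auto
    have "(a, c) \<in> inversions r \<longleftrightarrow> (a, c) \<in> inversions s" for a c
      by (rule trans[OF inv_iff[OF r] inv_iff[OF s, folded eq, symmetric]])
    then have "inversions r = inversions s" by (simp add: set_eq_iff)
    then show "r = s" by (rule eq_if_inversions_eq[OF TITO_linear[OF r(1)] TITO_linear[OF s(1)]])
  qed
qed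


section \<open>In-order and post-order of infinite binary trees\<close>

locale btree_structure =
  fixes T :: "'v btree"
  assumes tree: "binary_tree T"
begin

lemma child_acyclic: "(u, v) \<in> child_rel T \<Longrightarrow> (v, u) \<notin> descendant_rel T"
  using tree unfolding binary_tree_def acyclic_def descendant_rel_def
  by (metis rtrancl_into_trancl2)

lemma parent_unique: "(c, v) \<in> child_rel T \<Longrightarrow> (c, w) \<in> child_rel T \<Longrightarrow> v = w"
  using tree unfolding binary_tree_def by blast

lemma common_ancestor: "\<exists>w. (u, w) \<in> descendant_rel T \<and> (v, w) \<in> descendant_rel T"
  using tree unfolding binary_tree_def by blast

lemma descendant_refl: "(u, u) \<in> descendant_rel T"
  by (simp add: descendant_rel_def)

lemma descendant_trans:
  "(u, v) \<in> descendant_rel T \<Longrightarrow> (v, w) \<in> descendant_rel T \<Longrightarrow> (u, w) \<in> descendant_rel T"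
  by (simp add: descendant_rel_def)

lemma descendant_antisym:
  assumes "(u, v) \<in> descendant_rel T" "(v, u) \<in> descendant_rel T"
  shows "u = v"
  using assms tree unfolding binary_tree_def descendant_rel_def
  by (meson acyclic_impl_antisym_rtrancl antisymD)

text \<open>Both \<open>v\<close> and \<open>w\<close> lie on the unique path that climbs from \<open>u\<close> through the parents.\<close>

lemma ancestors_chain:
  assumes "(u, v) \<in> descendant_rel T" "(u, w) \<in> descendant_rel T"
  shows "(v, w) \<in> descendant_rel T \<or> (w, v) \<in> descendant_rel T"
  using assms unfolding descendant_rel_def
proof (induction arbitrary: rule: rtrancl_induct)
  case (step y z)
  then consider "(y, w) \<in> (child_rel T)\<^sup>*" | "(w, y) \<in> (child_rel T)\<^sup>*" by blast
  then show ?case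
  proof cases
    case 1
    then show ?thesis
    proof (cases rule: converse_rtranclE)
      case base then show ?thesis using step.hyps(2) by blast
    next
      case (step z') then show ?thesis using parent_unique \<open>(y, z) \<in> child_rel T\<close> by blast
    qed
  qed (use step.hyps(2) in \<open>auto intro: rtrancl_into_rtrancl\<close>)
qed simp

lemma descendant_iff:
  "(u, v) \<in> descendant_rel T \<longleftrightarrow> u = v \<or> u \<in> left_subtree T v \<or> u \<in> right_subtree T v"
proof
  assume "(u, v) \<in> descendant_rel T"
  then show "u = v \<or> u \<in> left_subtree T v \<or> u \<in> right_subtree T v"
    unfolding left_subtree_def right_subtree_def descendant_rel_def
    by (cases rule: rtranclE) (auto simp: child_rel_def)
next
  assume "u = v \<or> u \<in> left_subtree T v \<or> u \<in> right_subtree T v"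
  then show "(u, v) \<in> descendant_rel T"
    unfolding left_subtree_def right_subtree_def descendant_rel_def
    by (auto simp: child_rel_def intro: rtrancl_into_rtrancl)
qed

lemma not_in_own_subtree: "v \<notin> left_subtree T v" "v \<notin> right_subtree T v"
  using child_acyclic by (auto simp: left_subtree_def right_subtree_def child_rel_def)

lemma subtrees_disjoint: "u \<in> left_subtree T v \<Longrightarrow> u \<notin> right_subtree T v"
proof
  assume "u \<in> left_subtree T v" "u \<in> right_subtree T v"
  then obtain c d where cd: "left_child T v = Some c" "right_child T v = Some d"
    "(u, c) \<in> descendant_rel T" "(u, d) \<in> descendant_rel T"
    by (auto simp: left_subtree_def right_subtree_def)
  have child: "(c, v) \<in> child_rel T" "(d, v) \<in> child_rel T" using cd by (auto simp: child_rel_def)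
  have ne: "c \<noteq> d" using cd tree unfolding binary_tree_def by auto
  have *: False if cd: "(c, d) \<in> descendant_rel T" "c \<noteq> d"
    and child: "(c, v) \<in> child_rel T" "(d, v) \<in> child_rel T" for c d
  proof -
    obtain y where "(c, y) \<in> child_rel T" "(y, d) \<in> descendant_rel T"
      using cd unfolding descendant_rel_def by (metis converse_rtranclE)
    then show False using parent_unique child child_acyclic by blast
  qed
  show False using ancestors_chain[OF cd(3,4)] *[of c d] *[of d c] ne child by auto
qed

lemma descendant_in_left_subtree:
  "(u, w) \<in> descendant_rel T \<Longrightarrow> w \<in> left_subtree T v \<Longrightarrow> u \<in> left_subtree T v"
  using descendant_trans by (auto simp: left_subtree_def)

lemma descendant_in_right_subtree:
  "(u, w) \<in> descendant_rel T \<Longrightarrow> w \<in> right_subtree T v \<Longrightarrow> u \<in> right_subtree T v"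
  using descendant_trans by (auto simp: right_subtree_def)

text \<open>Starting from a common ancestor, descend towards \<open>v\<close> until the path leaves the ancestors of \<open>u\<close>.
  This is what makes the orders obtained by reading a tree unique although there may be no root.\<close>

lemma comparable_or_separated:
  "(u, v) \<in> descendant_rel T \<or> (v, u) \<in> descendant_rel T \<or>
    (\<exists>x. u \<in> left_subtree T x \<and> v \<in> right_subtree T x \<or> v \<in> left_subtree T x \<and> u \<in> right_subtree T x)"
proof -
  obtain w where uw: "(u, w) \<in> descendant_rel T" and vw: "(v, w) \<in> descendant_rel T"
    using common_ancestor by blast
  from vw[unfolded descendant_rel_def] uw show ?thesis
  proof (induction rule: rtrancl_induct)
    case (step y z)
    show ?case
    proof (cases "(u, y) \<in> descendant_rel T")
      case False
      have vz: "(v, z) \<in> descendant_rel T" "(v, y) \<in> descendant_rel T"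
        using step.hyps by (auto simp: descendant_rel_def)
      consider "u = z" | "u \<in> left_subtree T z" | "u \<in> right_subtree T z"
        using step.prems descendant_iff by blast
      then show ?thesis
      proof cases
        case 2
        then have "left_child T z \<noteq> Some y" using False by (auto simp: left_subtree_def)
        then have "v \<in> right_subtree T z"
          using step.hyps(2) vz(2) by (auto simp: child_rel_def right_subtree_def)
        then show ?thesis using 2 by blast
      next
        case 3
        then have "right_child T z \<noteq> Some y" using False by (auto simp: right_subtree_def)
        then have "v \<in> left_subtree T z"
          using step.hyps(2) vz(2) by (auto simp: child_rel_def left_subtree_def)
        then show ?thesis using 3 by blast
      qed (use vz in simp)
    qed (use step.IH in simp)
  qed simp
qed

definition is_in_order :: "'v rel \<Rightarrow> bool" where
  "is_in_order r \<longleftrightarrow> linear_order_on UNIV r \<and>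
     (\<forall>v. (\<forall>u \<in> left_subtree T v. (u, v) \<in> r) \<and> (\<forall>w \<in> right_subtree T v. (v, w) \<in> r))"

lemma is_in_order_unique:
  assumes r: "is_in_order r" and s: "is_in_order s"
  shows "r = s"
proof (rule linear_order_subset_eq)
  show lin: "linear_order_on UNIV r" "linear_order_on UNIV s"
    using r s by (auto simp: is_in_order_def)
  have right: "(v, u) \<in> t" if "is_in_order t" "u \<in> right_subtree T v" for t u v
    using that by (auto simp: is_in_order_def)
  have left: "(u, v) \<in> t" if "is_in_order t" "u \<in> left_subtree T v" for t u v
    using that by (auto simp: is_in_order_def)
  have both: "(u, v) \<in> t" if "is_in_order t" "u \<in> left_subtree T x" "v \<in> right_subtree T x" for t u v x
    using left[OF that(1,2)] right[OF that(1,3)] that(1) linear_order_trans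
    unfolding is_in_order_def by metis
  have anti: "u = v" if "(u, v) \<in> r" "(v, u) \<in> r" for u v
    using that linear_order_antisym[OF lin(1)] by blast
  show "r \<subseteq> s"
  proof clarify
    fix u v assume uv: "(u, v) \<in> r"
    have refl: "u = v \<Longrightarrow> (u, v) \<in> s" using linear_order_refl[OF lin(2)] by simp
    consider "u = v" | "u \<in> left_subtree T v" | "u \<in> right_subtree T v"
      | "v \<in> left_subtree T u" | "v \<in> right_subtree T u"
      | x where "u \<in> left_subtree T x" "v \<in> right_subtree T x"
      | x where "v \<in> left_subtree T x" "u \<in> right_subtree T x"
      using comparable_or_separated[of u v] descendant_iff by metis
    then show "(u, v) \<in> s"
    proof cases
      case 2 then show ?thesis using left[OF s] by blast
    next
      case 3 then show ?thesis using right[OF r] anti[OF uv] refl by blast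
    next
      case 4 then show ?thesis using left[OF r] anti[OF uv] refl by blast
    next
      case 5 then show ?thesis using right[OF s] by blast
    next
      case 6 then show ?thesis using both[OF s] by blast
    next
      case 7 then show ?thesis using both[OF r] anti[OF uv] refl by blast
    qed (use refl in simp)
  qed
qed

text \<open>The node \<open>x\<close> witnesses that \<open>u\<close> precedes \<open>v\<close> in in-order.\<close>

definition precedes_at :: "'v \<Rightarrow> 'v \<Rightarrow> 'v \<Rightarrow> bool" where
  "precedes_at x u v \<longleftrightarrow>
     u \<in> left_subtree T x \<and> (v = x \<or> v \<in> right_subtree T x) \<or> u = x \<and> v \<in> right_subtree T x"

lemma precedes_at_descendant:
  "precedes_at x u v \<Longrightarrow> (u, x) \<in> descendant_rel T \<and> (v, x) \<in> descendant_rel T"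
  unfolding precedes_at_def using descendant_iff by blast

text \<open>From the point of view of a strict ancestor \<open>y\<close> of \<open>x\<close>, all descendants of \<open>x\<close> lie in the same subtree
  and hence compare alike with any other node.\<close>

lemma precedes_at_below:
  assumes "(x, y) \<in> descendant_rel T" "x \<noteq> y"
    and "(u, x) \<in> descendant_rel T" "(v, x) \<in> descendant_rel T"
  shows "precedes_at y u w \<longleftrightarrow> precedes_at y v w" and "precedes_at y w u \<longleftrightarrow> precedes_at y w v"
proof -
  have "x \<in> left_subtree T y \<or> x \<in> right_subtree T y" using assms descendant_iff by blast
  then have "u \<in> left_subtree T y \<and> v \<in> left_subtree T y \<or> u \<in> right_subtree T y \<and> v \<in> right_subtree T y"
    using assms(3,4) descendant_in_left_subtree descendant_in_right_subtree by blast
  then show "precedes_at y u w \<longleftrightarrow> precedes_at y v w" "precedes_at y w u \<longleftrightarrow> precedes_at y w v"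
    unfolding precedes_at_def using subtrees_disjoint not_in_own_subtree by metis+
qed

lemma precedes_at_irrefl: "\<not> precedes_at x u u"
  unfolding precedes_at_def using subtrees_disjoint not_in_own_subtree by metis

lemma precedes_at_trans: "precedes_at x u v \<Longrightarrow> precedes_at x v w \<Longrightarrow> precedes_at x u w"
  unfolding precedes_at_def using subtrees_disjoint not_in_own_subtree by metis

text \<open>The two witnesses in a chain \<open>u\<close>, \<open>v\<close>, \<open>w\<close> are both ancestors of \<open>v\<close> and therefore comparable; the upper
  one also witnesses that \<open>u\<close> precedes \<open>w\<close>. Existence is needed because \<open>in_order\<close> is a definite
  description, about which nothing is known otherwise.\<close>

lemma is_in_order_exists: "is_in_order {(u, v). u = v \<or> (\<exists>x. precedes_at x u v)}"
  (is "is_in_order ?r")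
  unfolding is_in_order_def
proof
  have trans: "\<exists>z. precedes_at z u w" if uv: "precedes_at x u v" and vw: "precedes_at y v w" for u v w x y
  proof (cases "x = y")
    case True then show ?thesis using that precedes_at_trans by blast
  next
    case False
    have d: "(u, x) \<in> descendant_rel T" "(v, x) \<in> descendant_rel T"
      "(v, y) \<in> descendant_rel T" "(w, y) \<in> descendant_rel T"
      using uv vw precedes_at_descendant by blast+
    then consider "(x, y) \<in> descendant_rel T" | "(y, x) \<in> descendant_rel T"
      using ancestors_chain by blast
    then show ?thesis
    proof cases
      case 1 then show ?thesis using precedes_at_below(1)[OF 1 False d(1,2)] vw by blast
    next
      case 2 then show ?thesis using precedes_at_below(2)[OF 2 False[symmetric] d(3,4)] uv by blast
    qed
  qed
  have asym: "\<not> precedes_at y v u" if "precedes_at x u v" for u v x y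
  proof
    assume vu: "precedes_at y v u"
    have "\<exists>z. precedes_at z u u" using trans that vu by blast
    then show False using precedes_at_irrefl by blast
  qed
  have total: "u = v \<or> (\<exists>x. precedes_at x u v) \<or> (\<exists>x. precedes_at x v u)" for u v
    using comparable_or_separated[of u v] descendant_iff[of u v] descendant_iff[of v u]
    unfolding precedes_at_def by metis
  show "linear_order_on UNIV ?r"
    unfolding linear_order_on_UNIV_iff mem_Collect_eq case_prod_conv
  proof (intro conjI allI impI)
    show "a = c \<or> (\<exists>x. precedes_at x a c)"
      if "a = b \<or> (\<exists>x. precedes_at x a b)" "b = c \<or> (\<exists>x. precedes_at x b c)" for a b c
      using that trans by metis
    show "a = b" if "a = b \<or> (\<exists>x. precedes_at x a b)" "b = a \<or> (\<exists>x. precedes_at x b a)" for a b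
      using that asym by metis
    show "(a = b \<or> (\<exists>x. precedes_at x a b)) \<or> b = a \<or> (\<exists>x. precedes_at x b a)" for a b
      using total by metis
  qed simp
qed (auto simp: precedes_at_def)

lemma in_order_eqI:
  assumes "is_in_order r"
  shows "in_order T = r"
  unfolding in_order_def is_in_order_def[symmetric]
  by (rule the_equality) (rule assms, rule is_in_order_unique[OF _ assms])

lemma is_in_order_in_order: "is_in_order (in_order T)"
  using in_order_eqI[OF is_in_order_exists] is_in_order_exists by simp

lemma post_order_eqI:
  assumes r: "linear_order_on UNIV r"
    and lr: "\<And>u v w. u \<in> left_subtree T v \<Longrightarrow> w \<in> right_subtree T v \<Longrightarrow> (u, w) \<in> r"
    and desc: "descendant_rel T \<subseteq> r"
  shows "post_order T = r"
  unfolding post_order_def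
proof (rule the_equality)
  show "linear_order_on UNIV r \<and>
     (\<forall>v. (\<forall>u \<in> left_subtree T v. \<forall>w \<in> right_subtree T v. (u, w) \<in> r) \<and>
          (\<forall>u \<in> left_subtree T v \<union> right_subtree T v. (u, v) \<in> r))"
    using r lr desc descendant_iff by blast
next
  fix s
  assume s: "linear_order_on UNIV s \<and>
     (\<forall>v. (\<forall>u \<in> left_subtree T v. \<forall>w \<in> right_subtree T v. (u, w) \<in> s) \<and>
          (\<forall>u \<in> left_subtree T v \<union> right_subtree T v. (u, v) \<in> s))"
  then have ls: "linear_order_on UNIV s" by blast
  have desc_s: "descendant_rel T \<subseteq> s"
  proof clarify
    fix u v assume "(u, v) \<in> descendant_rel T"
    then show "(u, v) \<in> s" using s linear_order_refl[OF ls] descendant_iff[of u v] by blast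
  qed
  show "s = r"
  proof (rule linear_order_subset_eq[OF r ls, symmetric], clarify)
    fix u v assume uv: "(u, v) \<in> r"
    consider "(u, v) \<in> descendant_rel T" | "(v, u) \<in> descendant_rel T"
      | x where "u \<in> left_subtree T x" "v \<in> right_subtree T x"
      | x where "v \<in> left_subtree T x" "u \<in> right_subtree T x"
      using comparable_or_separated[of u v] by metis
    then show "(u, v) \<in> s"
    proof cases
      case 2
      then have "u = v" using uv desc linear_order_antisym[OF r] by blast
      then show ?thesis using linear_order_refl[OF ls] by simp
    next
      case 4
      then have "u = v" using uv lr linear_order_antisym[OF r] by blast
      then show ?thesis using linear_order_refl[OF ls] by simp
    qed (use s desc_s in blast)+
  qed
qed

end


section \<open>TIBITs and their descendant orders\<close>

text \<open>The \<open>D\<close>-greatest element of \<open>A\<close>, if there is one: a child of \<open>v\<close> is the topmost of the descendants of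
  \<open>v\<close> on its side.\<close>

definition apex :: "'v rel \<Rightarrow> 'v set \<Rightarrow> 'v option" where
  "apex D A = (if \<exists>c\<in>A. \<forall>u\<in>A. (u, c) \<in> D then Some (THE c. c \<in> A \<and> (\<forall>u\<in>A. (u, c) \<in> D)) else None)"

definition tree_of_descendants :: "int rel \<Rightarrow> int btree" where
  "tree_of_descendants D =
     \<lparr>left_child = \<lambda>v. apex D {u. u < v \<and> (u, v) \<in> D},
      right_child = \<lambda>v. apex D {u. v < u \<and> (u, v) \<in> D}\<rparr>"

lemma apex_eq_Some_iff:
  assumes "\<And>u v. (u, v) \<in> D \<Longrightarrow> (v, u) \<in> D \<Longrightarrow> u = v"
  shows "apex D A = Some c \<longleftrightarrow> c \<in> A \<and> (\<forall>u\<in>A. (u, c) \<in> D)"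
proof -
  have "(THE c. c \<in> A \<and> (\<forall>u\<in>A. (u, c) \<in> D)) = c" if "c \<in> A" "\<forall>u\<in>A. (u, c) \<in> D" for c
    using that assms by (intro the_equality) auto
  then show ?thesis unfolding apex_def by auto
qed

context descendant_order
begin

lemma left_child_tree_of_descendants:
  "left_child (tree_of_descendants D) v = Some c \<longleftrightarrow>
    c < v \<and> (c, v) \<in> D \<and> (\<forall>u. u < v \<longrightarrow> (u, v) \<in> D \<longrightarrow> (u, c) \<in> D)"
  using apex_eq_Some_iff[OF antisym] by (auto simp: tree_of_descendants_def)

lemma right_child_tree_of_descendants:
  "right_child (tree_of_descendants D) v = Some c \<longleftrightarrow>
    v < c \<and> (c, v) \<in> D \<and> (\<forall>u. v < u \<longrightarrow> (u, v) \<in> D \<longrightarrow> (u, c) \<in> D)"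
  using apex_eq_Some_iff[OF antisym] by (auto simp: tree_of_descendants_def)

lemma comparable_above:
  assumes "(u, v) \<in> D" "(u, w) \<in> D"
  shows "(v, w) \<in> D \<or> (w, v) \<in> D"
proof -
  obtain x where x: "v \<le> x \<and> x \<le> w \<or> w \<le> x \<and> x \<le> v" "(v, x) \<in> D" "(w, x) \<in> D"
    using peak[of v w] peak[of w v] by (meson linear)
  have "u \<le> x \<and> x \<le> v \<or> v \<le> x \<and> x \<le> u \<or> u \<le> x \<and> x \<le> w \<or> w \<le> x \<and> x \<le> u"
    using x(1) by linarith
  then have "(x, v) \<in> D \<or> (x, w) \<in> D" using assms convex by blast
  then show ?thesis using x antisym by metis
qed

end

text \<open>In an infinite descendant order a nonempty side of \<open>v\<close> could fail to have a topmost element, and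
  infinitely many nodes could lie between a node and its descendant. These axioms exclude
  both, so that \<open>D\<close> is generated by its covering relation.\<close>

locale branching_order = descendant_order +
  assumes left_top: "u < v \<Longrightarrow> (u, v) \<in> D \<Longrightarrow>
      \<exists>c<v. (c, v) \<in> D \<and> (\<forall>w<v. (w, v) \<in> D \<longrightarrow> (w, c) \<in> D)"
    and right_top: "v < u \<Longrightarrow> (u, v) \<in> D \<Longrightarrow>
      \<exists>c>v. (c, v) \<in> D \<and> (\<forall>w>v. (w, v) \<in> D \<longrightarrow> (w, c) \<in> D)"
    and finite_between: "(u, v) \<in> D \<Longrightarrow> finite {w. (u, w) \<in> D \<and> (w, v) \<in> D}"
begin

abbreviation T :: "int btree" where "T \<equiv> tree_of_descendants D"

lemma child_rel_T: "(c, v) \<in> child_rel T \<longleftrightarrow> (c, v) \<in> D \<and>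
    (c < v \<and> (\<forall>u. u < v \<longrightarrow> (u, v) \<in> D \<longrightarrow> (u, c) \<in> D) \<or>
     v < c \<and> (\<forall>u. v < u \<longrightarrow> (u, v) \<in> D \<longrightarrow> (u, c) \<in> D))"
  unfolding child_rel_def
  by (auto simp: left_child_tree_of_descendants right_child_tree_of_descendants)

lemma descendant_rel_T: "descendant_rel T = D"
proof (intro equalityI subrelI)
  fix u v assume "(u, v) \<in> descendant_rel T"
  then show "(u, v) \<in> D"
    unfolding descendant_rel_def
  proof (induction rule: rtrancl_induct)
    case base then show ?case by (rule refl)
  next
    case (step y z) then show ?case using child_rel_T trans by blast
  qed
next
  fix u v assume uv: "(u, v) \<in> D"
  have "(u, v) \<in> (child_rel T)\<^sup>*"
    using uv
  proof (induction "card {w. (u, w) \<in> D \<and> (w, v) \<in> D}" arbitrary: v rule: less_induct)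
    case less
    show ?case
    proof (cases "u = v")
      case False
      then obtain c where c: "(c, v) \<in> child_rel T" "(u, c) \<in> D" "(c, v) \<in> D" "c \<noteq> v"
        using left_top[of u v] right_top[of v u] less.prems child_rel_T
        by (metis linorder_neq_iff)
      have "{w. (u, w) \<in> D \<and> (w, c) \<in> D} \<subset> {w. (u, w) \<in> D \<and> (w, v) \<in> D}"
        using c less.prems trans antisym refl by blast
      then have "card {w. (u, w) \<in> D \<and> (w, c) \<in> D} < card {w. (u, w) \<in> D \<and> (w, v) \<in> D}"
        using finite_between[OF less.prems] by (rule psubset_card_mono[rotated])
      then have "(u, c) \<in> (child_rel T)\<^sup>*" using less.hyps c(2) by blast
      then show ?thesis using c(1) by (rule rtrancl_into_rtrancl)
    qed simp
  qed
  then show "(u, v) \<in> descendant_rel T" by (simp add: descendant_rel_def)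
qed

lemma left_subtree_T: "u \<in> left_subtree T v \<Longrightarrow> u < v"
proof -
  assume "u \<in> left_subtree T v"
  then obtain c where c: "c < v" "(c, v) \<in> D" "(u, c) \<in> D"
    by (auto simp: left_subtree_def descendant_rel_T left_child_tree_of_descendants)
  then show "u < v" using convex[of u c v] antisym[of c v] by linarith
qed

lemma right_subtree_T: "u \<in> right_subtree T v \<Longrightarrow> v < u"
proof -
  assume "u \<in> right_subtree T v"
  then obtain c where c: "v < c" "(c, v) \<in> D" "(u, c) \<in> D"
    by (auto simp: right_subtree_def descendant_rel_T right_child_tree_of_descendants)
  then show "v < u" using convex[of u c v] antisym[of c v] by linarith
qed

lemma binary_tree_T: "binary_tree T"
  unfolding binary_tree_def
proof (intro conjI allI impI)
  show "acyclic (child_rel T)"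
    unfolding acyclic_def
  proof clarify
    fix x assume "(x, x) \<in> (child_rel T)\<^sup>+"
    then obtain y where "(x, y) \<in> child_rel T" "(y, x) \<in> (child_rel T)\<^sup>*" by (meson tranclD)
    then show False
      using child_rel_T[of x y] antisym[of x y] descendant_rel_T by (auto simp: descendant_rel_def)
  qed
  show "v = w" if cvw: "(c, v) \<in> child_rel T \<and> (c, w) \<in> child_rel T" for c v w
  proof -
    have *: "v = w" if cv: "(c, v) \<in> child_rel T" and cw: "(c, w) \<in> child_rel T" and vw: "(v, w) \<in> D" for v w
    proof (rule ccontr)
      assume "v \<noteq> w"
      have cD: "(c, v) \<in> D" "(c, w) \<in> D" "c \<noteq> v" "c \<noteq> w" using cv cw child_rel_T by blast+
      \<comment> \<open>The nodes \<open>v\<close> and \<open>c\<close> are on the same side of \<open>w\<close>, and \<open>c\<close> is topmost on that side.\<close>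
      have "(v, c) \<in> D"
      proof (cases "c < w")
        case True
        then have "v < w" using convex[of c w v] convex[of c v w] antisym[OF vw] cD \<open>v \<noteq> w\<close> by linarith
        then show ?thesis using True cw vw child_rel_T by auto
      next
        case False
        then have "w < v" using convex[of c w v] convex[of c v w] antisym[OF vw] cD \<open>v \<noteq> w\<close> by linarith
        then show ?thesis using False cw vw child_rel_T by auto
      qed
      then show False using cD antisym by blast
    qed
    have "(v, w) \<in> D \<or> (w, v) \<in> D" using cvw child_rel_T comparable_above by blast
    then show ?thesis using *[of v w] *[of w v] cvw by blast
  qed
  show "\<not> (left_child T v = Some c \<and> right_child T v = Some c)" for c v
    by (auto simp: left_child_tree_of_descendants right_child_tree_of_descendants)
  show "\<exists>w. (u, w) \<in> descendant_rel T \<and> (v, w) \<in> descendant_rel T" for u v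
    unfolding descendant_rel_T using peak[of u v] peak[of v u] by (meson linear)
qed

sublocale btree_structure T
  by standard (rule binary_tree_T)

lemma in_order_T: "in_order T = {(a, b). a \<le> b}"
  by (rule in_order_eqI)
    (auto simp: is_in_order_def linear_order_on_UNIV_iff dest: left_subtree_T right_subtree_T)

lemma tree_of_descendants_TIBIT:
  assumes inv: "\<And>u v. (u, v) \<in> D \<longleftrightarrow> (u + n, v + n) \<in> D"
  shows "T \<in> TIBIT n"
proof -
  \<comment> \<open>Reindexing the quantifier by \<open>u + n\<close> lines it up with the shifted arguments.\<close>
  have all: "(\<forall>u. P u) \<longleftrightarrow> (\<forall>u. P (u + n))" for P :: "int \<Rightarrow> bool"
    by (metis diff_add_cancel)
  have "left_child T b = Some a \<longleftrightarrow> left_child T (b + n) = Some (a + n)" for a b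
    unfolding left_child_tree_of_descendants
    by (subst (2) all) (simp add: inv[symmetric])
  moreover have "right_child T b = Some a \<longleftrightarrow> right_child T (b + n) = Some (a + n)" for a b
    unfolding right_child_tree_of_descendants
    by (subst (2) all) (simp add: inv[symmetric])
  ultimately show ?thesis
    unfolding TIBIT_def using binary_tree_T by (auto simp: in_order_T)
qed

end

text \<open>Infinitely many integers may be dominated by \<open>v\<close> from the left. The \<open>r\<close>-largest of those in the last
  period \<open>{v - n..<v}\<close> nevertheless beats all of them: if \<open>w < v - n\<close> is dominated by \<open>v\<close>, so is \<open>w + n\<close>,
  and translating back shows that \<open>w\<close> comes before \<open>v - n\<close>.\<close>

lemma dominance_left_top:
  assumes n: "n \<ge> 1" and r: "r \<in> TITO n" and uv: "u < v" "(u, v) \<in> dominance r"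
  shows "\<exists>c<v. (c, v) \<in> dominance r \<and> (\<forall>w<v. (w, v) \<in> dominance r \<longrightarrow> (w, c) \<in> dominance r)"
proof -
  note lin = TITO_linear[OF r]
  interpret descendant_order "dominance r" using TITO_dominance[OF r] .
  define A where "A = {w \<in> {v - n..<v}. (w, v) \<in> dominance r}"
  have "v - 1 \<in> A" using n uv convex[OF uv(2), of "v - 1"] by (simp add: A_def)
  moreover have "finite A" unfolding A_def by (rule finite_subset[of _ "{v - n..<v}"]) auto
  ultimately obtain c where c: "c \<in> A" "\<forall>a\<in>A. (a, c) \<in> r"
    using finite_has_linear_order_max[OF lin] by blast
  have top: "(w, c) \<in> r" if w: "w < v" "(w, v) \<in> dominance r" for w
  proof (cases "v - n \<le> w")
    case True then show ?thesis using w c(2) by (simp add: A_def)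
  next
    case False
    have "v - n \<in> A" using False n convex[OF w(2), of "v - n"] by (simp add: A_def)
    moreover have "(w + n, v) \<in> r"
      using False n convex[OF w(2), of "w + n"] dominance_subset by auto
    then have "(w, v - n) \<in> r" using TITO_translate[OF r, of w "v - n" 1] by simp
    ultimately show ?thesis using c(2) linear_order_trans[OF lin] by blast
  qed
  have "(w, c) \<in> dominance r" if w: "w < v" "(w, v) \<in> dominance r" for w
    unfolding dominance_def
  proof clarify
    fix x assume x: "w \<le> x \<and> x \<le> c \<or> c \<le> x \<and> x \<le> w"
    have cv: "c < v" "(c, v) \<in> dominance r" using c(1) by (auto simp: A_def)
    then have "x < v" using x w by linarith
    moreover have "(x, v) \<in> dominance r"
      using x w cv convex[OF w(2), of x] convex[OF cv(2), of x] by linarith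
    ultimately show "(x, c) \<in> r" by (rule top)
  qed
  then show ?thesis using c(1) by (auto simp: A_def)
qed

text \<open>Choose a translate \<open>b\<close> of \<open>v\<close> with \<open>b \<le> u\<close>. An integer \<open>w < b\<close> dominated by \<open>v\<close> comes before \<open>b\<close> by
  translation, but it would come after \<open>b\<close> if it dominated \<open>u\<close>. So everything between \<open>u\<close> and \<open>v\<close> in the
  dominance order lies in \<open>{b..v}\<close>.\<close>

lemma dominance_finite_between_left:
  assumes n: "n \<ge> 1" and r: "r \<in> TITO n" and uv: "u < v" "(u, v) \<in> dominance r"
  shows "finite {w. (u, w) \<in> dominance r \<and> (w, v) \<in> dominance r}"
proof (rule finite_subset)
  note lin = TITO_linear[OF r]
  interpret descendant_order "dominance r" using TITO_dominance[OF r] .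
  \<comment> \<open>Since \<open>n \<ge> 1\<close>, going down \<open>v - u\<close> periods is enough to get to \<open>u\<close> or below.\<close>
  define b where "b = v - (v - u) * n"
  have "(v - u) * 1 \<le> (v - u) * n" using n uv by (intro mult_left_mono) auto
  then have b: "b \<le> u" by (simp add: b_def)
  show "{w. (u, w) \<in> dominance r \<and> (w, v) \<in> dominance r} \<subseteq> {b..v}"
  proof clarify
    fix w assume w: "(u, w) \<in> dominance r" "(w, v) \<in> dominance r"
    have "w \<le> v"
      using uv w convex[of u w v] antisym[of v w] by (cases "w \<le> v") auto
    moreover have "b \<le> w"
    proof (rule ccontr)
      assume "\<not> b \<le> w"
      then have "(w + (v - u) * n, v) \<in> dominance r"
        using uv n by (intro convex[OF w(2)]) (auto simp: b_def)
      then have "(w, b) \<in> r"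
        using dominance_subset TITO_translate[OF r, of w b "v - u"] by (auto simp: b_def)
      moreover have "(b, w) \<in> dominance r"
        using \<open>\<not> b \<le> w\<close> b by (intro convex[OF w(1)]) auto
      ultimately have "w = b"
        using dominance_subset linear_order_antisym[OF lin] by blast
      then show False using \<open>\<not> b \<le> w\<close> by simp
    qed
    ultimately show "w \<in> {b..v}" by simp
  qed
qed simp

text \<open>Reflecting the integers exchanges the two sides of each node, so that only left sides need the
  arguments above.\<close>

definition mirror :: "int rel \<Rightarrow> int rel" where
  "mirror r = {(a, b). (- a, - b) \<in> r}"

lemma mirror_TITO:
  assumes r: "r \<in> TITO n"
  shows "mirror r \<in> TITO n"
proof -
  have "(- a, - b) \<in> r \<longleftrightarrow> (- (a + n), - (b + n)) \<in> r" for a b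
    using TITO_translate[OF r, of "- a" "- b" "- 1"] by simp
  moreover have "linear_order_on UNIV (mirror r)"
    using TITO_linear[OF r] unfolding linear_order_on_UNIV_iff mirror_def
    by simp (metis neg_equal_iff_equal)
  ultimately show ?thesis unfolding TITO_def mirror_def by blast
qed

lemma dominance_mirror: "(a, b) \<in> dominance (mirror r) \<longleftrightarrow> (- a, - b) \<in> dominance r"
proof -
  have mirrorI: "(a, b) \<in> dominance (mirror r)" if "(- a, - b) \<in> dominance r" for a b r
    unfolding dominance_def
  proof clarify
    fix w assume "a \<le> w \<and> w \<le> b \<or> b \<le> w \<and> w \<le> a"
    then have "- a \<le> - w \<and> - w \<le> - b \<or> - b \<le> - w \<and> - w \<le> - a" by linarith
    then show "(w, b) \<in> mirror r" using that unfolding dominance_def mirror_def by blast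
  qed
  have "mirror (mirror r) = r" by (simp add: mirror_def)
  then show ?thesis using mirrorI[of a b r] mirrorI[of "- a" "- b" "mirror r"] by auto
qed

lemma dominance_branching_order:
  assumes n: "n \<ge> 1" and r: "r \<in> TITO n"
  shows "branching_order (dominance r)"
proof -
  interpret descendant_order "dominance r" using TITO_dominance[OF r] .
  note m = mirror_TITO[OF r]
  show ?thesis
  proof
    show "\<exists>c<v. (c, v) \<in> dominance r \<and> (\<forall>w<v. (w, v) \<in> dominance r \<longrightarrow> (w, c) \<in> dominance r)"
      if "u < v" "(u, v) \<in> dominance r" for u v
      using dominance_left_top[OF n r that] .
    show "\<exists>c>v. (c, v) \<in> dominance r \<and> (\<forall>w>v. (w, v) \<in> dominance r \<longrightarrow> (w, c) \<in> dominance r)"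
      if vu: "v < u" "(u, v) \<in> dominance r" for u v
    proof -
      obtain c where c: "c < - v" "(- c, v) \<in> dominance r"
        "\<forall>w. w < - v \<longrightarrow> (- w, v) \<in> dominance r \<longrightarrow> (- w, - c) \<in> dominance r"
        using dominance_left_top[OF n m, of "- u" "- v"] vu by (auto simp: dominance_mirror)
      have "(w, - c) \<in> dominance r" if "v < w" "(w, v) \<in> dominance r" for w
        using c(3)[rule_format, of "- w"] that by simp
      then show ?thesis using c by (intro exI[of _ "- c"]) auto
    qed
    show "finite {w. (u, w) \<in> dominance r \<and> (w, v) \<in> dominance r}"
      if uv: "(u, v) \<in> dominance r" for u v
    proof -
      consider "u = v" | "u < v" | "v < u" by linarith
      then show ?thesis
      proof cases
        case 1
        then have "{w. (u, w) \<in> dominance r \<and> (w, v) \<in> dominance r} \<subseteq> {u}" using antisym by blast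
        then show ?thesis by (rule finite_subset) simp
      next
        case 2 then show ?thesis using dominance_finite_between_left[OF n r] uv by blast
      next
        case 3
        have "finite {w. (- u, w) \<in> dominance (mirror r) \<and> (w, - v) \<in> dominance (mirror r)}"
          using dominance_finite_between_left[OF n m, of "- u" "- v"] 3 uv
          by (simp add: dominance_mirror)
        then have "finite (uminus ` {w. (u, - w) \<in> dominance r \<and> (- w, v) \<in> dominance r})"
          by (simp add: dominance_mirror)
        moreover have "{w. (u, w) \<in> dominance r \<and> (w, v) \<in> dominance r} \<subseteq>
          uminus ` {w. (u, - w) \<in> dominance r \<and> (- w, v) \<in> dominance r}"
          by (auto intro: image_eqI[of _ _ "- _"])
        ultimately show ?thesis by (rule finite_subset[rotated])
      qed
    qed
  qed
qed

locale tibit =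
  fixes n :: int and T :: "int btree"
  assumes TIBIT: "T \<in> TIBIT n"
begin

sublocale btree_structure T
  using TIBIT by unfold_locales (simp add: TIBIT_def)

lemma left_subtree_less: "u \<in> left_subtree T v \<Longrightarrow> u < v"
  and right_subtree_greater: "u \<in> right_subtree T v \<Longrightarrow> v < u"
proof -
  have less: "a < b \<longleftrightarrow> (a, b) \<in> in_order T \<and> a \<noteq> b" for a b
    using TIBIT by (simp add: TIBIT_def)
  show "u \<in> left_subtree T v \<Longrightarrow> u < v" "u \<in> right_subtree T v \<Longrightarrow> v < u"
    using is_in_order_in_order not_in_own_subtree unfolding is_in_order_def less by metis+
qed

lemma descendant_order: "descendant_order (descendant_rel T)"
proof
  show "(w, v) \<in> descendant_rel T"
    if uv: "(u, v) \<in> descendant_rel T" and w: "u \<le> w \<and> w \<le> v \<or> v \<le> w \<and> w \<le> u" for u v w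
  proof -
    have sides: "(u \<in> left_subtree T x \<longleftrightarrow> v \<in> left_subtree T x) \<and>
      (u \<in> right_subtree T x \<longleftrightarrow> v \<in> right_subtree T x)" if "(v, x) \<in> descendant_rel T" "v \<noteq> x" for x
      using that uv descendant_iff[of v x] descendant_in_left_subtree descendant_in_right_subtree
        subtrees_disjoint by metis
    consider "(w, v) \<in> descendant_rel T" | "(v, w) \<in> descendant_rel T" "v \<noteq> w"
      | x where "w \<in> left_subtree T x" "v \<in> right_subtree T x"
      | x where "v \<in> left_subtree T x" "w \<in> right_subtree T x"
      using comparable_or_separated[of w v] descendant_refl by metis
    then show ?thesis
    proof cases
      case 2
      then have "v \<in> left_subtree T w \<and> u \<in> left_subtree T w \<or> v \<in> right_subtree T w \<and> u \<in> right_subtree T w"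
        using sides[OF 2] descendant_iff by blast
      then show ?thesis using w left_subtree_less right_subtree_greater by fastforce
    next
      case 3
      then have "u \<in> right_subtree T x" using uv descendant_in_right_subtree by blast
      then show ?thesis using 3 w left_subtree_less right_subtree_greater by fastforce
    next
      case 4
      then have "u \<in> left_subtree T x" using uv descendant_in_left_subtree by blast
      then show ?thesis using 4 w left_subtree_less right_subtree_greater by fastforce
    qed simp
  qed
  show "\<exists>x. u \<le> x \<and> x \<le> v \<and> (u, x) \<in> descendant_rel T \<and> (v, x) \<in> descendant_rel T"
    if uv: "u \<le> v" for u v
  proof -
    consider "(u, v) \<in> descendant_rel T" | "(v, u) \<in> descendant_rel T"
      | x where "u \<in> left_subtree T x" "v \<in> right_subtree T x"
      | x where "v \<in> left_subtree T x" "u \<in> right_subtree T x"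
      using comparable_or_separated[of u v] by metis
    then show ?thesis
    proof cases
      case 1 then show ?thesis using uv descendant_refl by blast
    next
      case 2 then show ?thesis using uv descendant_refl by blast
    next
      case 3 then show ?thesis
        using left_subtree_less right_subtree_greater descendant_iff by (intro exI[of _ x]) fastforce
    next
      case 4 then show ?thesis
        using uv left_subtree_less right_subtree_greater by fastforce
    qed
  qed
qed (use descendant_refl descendant_antisym descendant_trans in blast)+

sublocale descendant_order "descendant_rel T"
  by (rule descendant_order)

text \<open>A TIBIT has no more information than its descendant relation, since the in-order tells left
  from right.\<close>

lemma eq_tree_of_descendants: "T = tree_of_descendants (descendant_rel T)"
proof -
  have left: "left_subtree T v = {u. u < v \<and> (u, v) \<in> descendant_rel T}" for v
    using descendant_iff left_subtree_less right_subtree_greater by fastforce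
  have right: "right_subtree T v = {u. v < u \<and> (u, v) \<in> descendant_rel T}" for v
    using descendant_iff left_subtree_less right_subtree_greater by fastforce
  have "left_child T v = Some c \<longleftrightarrow> left_child (tree_of_descendants (descendant_rel T)) v = Some c" for v c
  proof -
    have "left_child T v = Some c \<longleftrightarrow> c \<in> left_subtree T v \<and> (\<forall>u\<in>left_subtree T v. (u, c) \<in> descendant_rel T)"
      using descendant_refl descendant_antisym by (auto simp: left_subtree_def)
    then show ?thesis unfolding left_child_tree_of_descendants left by blast
  qed
  moreover have "right_child T v = Some c \<longleftrightarrow> right_child (tree_of_descendants (descendant_rel T)) v = Some c" for v c
  proof -
    have "right_child T v = Some c \<longleftrightarrow> c \<in> right_subtree T v \<and> (\<forall>u\<in>right_subtree T v. (u, c) \<in> descendant_rel T)"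
      using descendant_refl descendant_antisym by (auto simp: right_subtree_def)
    then show ?thesis unfolding right_child_tree_of_descendants right by blast
  qed
  moreover have "x = y" if "\<And>c. x = Some c \<longleftrightarrow> y = Some c" for x y :: "int option"
    using that by (cases x) (auto, metis not_None_eq)
  ultimately have "left_child T = left_child (tree_of_descendants (descendant_rel T))"
    "right_child T = right_child (tree_of_descendants (descendant_rel T))"
    by (simp_all add: fun_eq_iff)
  then show ?thesis by (rule btree.equality) simp
qed

lemma descendant_rel_translate:
  "(u, v) \<in> descendant_rel T \<longleftrightarrow> (u + n, v + n) \<in> descendant_rel T"
proof -
  have child: "(a, b) \<in> child_rel T \<longleftrightarrow> (a + n, b + n) \<in> child_rel T" for a b
    using TIBIT by (simp add: TIBIT_def child_rel_def)
  have "(u + n, v + n) \<in> descendant_rel T" if "(u, v) \<in> descendant_rel T" for u v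
    using that unfolding descendant_rel_def
    by induction (auto simp: child[symmetric] intro: rtrancl_into_rtrancl)
  moreover have "(u - n, v - n) \<in> descendant_rel T" if "(u, v) \<in> descendant_rel T" for u v
    using that unfolding descendant_rel_def
    by induction (auto simp: child[of "_ - n" "_ - n"] intro: rtrancl_into_rtrancl)
  from this[of "u + n" "v + n"] have "(u + n, v + n) \<in> descendant_rel T \<Longrightarrow> (u, v) \<in> descendant_rel T"
    by simp
  ultimately show ?thesis by blast
qed

lemma post_order_eq: "post_order T = lower_order (descendant_rel T)"
proof (rule post_order_eqI)
  show "linear_order_on UNIV (lower_order (descendant_rel T))" by (rule lower_order_linear)
  show "descendant_rel T \<subseteq> lower_order (descendant_rel T)" by (auto simp: lower_order_def)
  show "(u, w) \<in> lower_order (descendant_rel T)"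
    if u: "u \<in> left_subtree T v" and w: "w \<in> right_subtree T v" for u v w
  proof -
    have less: "u < v" "v < w" using u w left_subtree_less right_subtree_greater by blast+
    have "(w, u) \<notin> descendant_rel T"
      using convex[of w u v] antisym[of u v] less u descendant_iff[of u v] by auto
    then show ?thesis using less by (simp add: lower_order_def)
  qed
qed

lemma post_order_TITO: "post_order T \<in> TITO n"
  unfolding post_order_eq by (rule lower_order_TITO) (rule descendant_rel_translate)

lemma dominance_post_order: "dominance (post_order T) = descendant_rel T"
  unfolding post_order_eq by (rule dominance_lower_order)

text \<open>This turns the tree of an order into a matter of \<open>dominance\<close> and gives its uniqueness.\<close>

lemma linear_extension_iff:
  assumes r: "linear_order_on UNIV r"
  shows "linear_extension T r \<longleftrightarrow> dominance r = descendant_rel T"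
proof
  assume "linear_extension T r"
  then have child: "child_rel T \<subseteq> r" by (simp add: linear_extension_def)
  have "descendant_rel T \<subseteq> r"
  proof clarify
    fix u v assume "(u, v) \<in> descendant_rel T"
    then show "(u, v) \<in> r"
      unfolding descendant_rel_def
      by induction (use child linear_order_refl[OF r] linear_order_trans[OF r] in blast)+
  qed
  then show "dominance r = descendant_rel T" by (rule dominance_eq[OF r])
next
  assume "dominance r = descendant_rel T"
  then have "descendant_rel T \<subseteq> r" using dominance_subset by blast
  then show "linear_extension T r"
    using r by (auto simp: linear_extension_def descendant_rel_def)
qed

end

lemma tree_of_eq:
  assumes n: "n \<ge> 1" and r: "r \<in> TITO n"
  shows "tree_of n r = tree_of_descendants (dominance r)"
    and "tree_of n r \<in> TIBIT n"
    and "descendant_rel (tree_of n r) = dominance r"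
proof -
  interpret branching_order "dominance r" using dominance_branching_order[OF n r] .
  have T: "T \<in> TIBIT n"
    using dominance_translate[OF r, of _ _ 1] by (intro tree_of_descendants_TIBIT) simp
  interpret tibit n T by standard (rule T)
  have "linear_extension T r"
    using linear_extension_iff[OF TITO_linear[OF r]] descendant_rel_T by simp
  moreover have "S = T" if S: "S \<in> TIBIT n \<and> linear_extension S r" for S
  proof -
    interpret S: tibit n S by standard (use S in simp)
    have "dominance r = descendant_rel S"
      using S S.linear_extension_iff[OF TITO_linear[OF r]] by blast
    then show ?thesis using S.eq_tree_of_descendants by simp
  qed
  ultimately show eq: "tree_of n r = T"
    unfolding tree_of_def using T by (intro the_equality) blast+
  show "tree_of n r \<in> TIBIT n" "descendant_rel (tree_of n r) = dominance r"
    using T descendant_rel_T by (simp_all add: eq)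
qed

lemma tree_of_eq_iff:
  assumes "n \<ge> 1" "r \<in> TITO n" "s \<in> TITO n"
  shows "tree_of n r = tree_of n s \<longleftrightarrow> dominance r = dominance s"
  using tree_of_eq[OF assms(1,2)] tree_of_eq[OF assms(1,3)] by metis

lemma post_order_tree_of:
  assumes "n \<ge> 1" "r \<in> TITO n"
  shows "post_order (tree_of n r) = lower_order (dominance r)"
proof -
  interpret tibit n "tree_of n r" by standard (rule tree_of_eq(2)[OF assms])
  show ?thesis using post_order_eq tree_of_eq(3)[OF assms] by simp
qed

lemma tree_of_post_order:
  assumes n: "n \<ge> 1" and T: "T \<in> TIBIT n"
  shows "tree_of n (post_order T) = T"
proof -
  interpret tibit n T by standard (rule T)
  show ?thesis
    using tree_of_eq(1)[OF n post_order_TITO] dominance_post_order eq_tree_of_descendants by simp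
qed

lemma tree_of_image:
  assumes "n \<ge> 1"
  shows "tree_of n ` TITO n = TIBIT n"
proof
  show "tree_of n ` TITO n \<subseteq> TIBIT n" using tree_of_eq(2)[OF assms] by blast
  show "TIBIT n \<subseteq> tree_of n ` TITO n"
    using tree_of_post_order[OF assms] tibit.post_order_TITO[unfolded tibit_def] by (metis image_eqI subsetI)
qed


section \<open>The cyclic Tamari lattice as a quotient of the cyclic Dyer lattice\<close>

text \<open>The lower adjoint is the inclusion, the upper adjoint the upper projection.\<close>

lemma CTam312_hom:
  shows "complete_lattice (CTam312 n)"
    and "complete_lattice_hom (CDyer n) (CTam312 n) (\<lambda>r. lower_order (dominance r))"
proof -
  have carrier: "carrier (CTam312 n) = {r \<in> TITO n. avoids_312 r}" by (simp add: CTam312_def)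
  have le: "le (CTam312 n) = le (CDyer n)" by (simp add: CTam312_def)
  have in_carrier: "lower_order (dominance r) \<in> carrier (CTam312 n)" if "r \<in> TITO n" for r
    unfolding carrier
    using lower_dominance_TITO descendant_order.lower_order_avoids_312[OF TITO_dominance] that by blast
  have fixed: "t \<in> TITO n \<and> lower_order (dominance t) = t" if "t \<in> carrier (CTam312 n)" for t
    using that eq_lower_order_if_avoids_312[OF TITO_linear] by (auto simp: carrier)
  have image: "(\<lambda>r. lower_order (dominance r)) ` carrier (CDyer n) = carrier (CTam312 n)"
  proof (intro equalityI subsetI)
    fix t assume "t \<in> carrier (CTam312 n)"
    then show "t \<in> (\<lambda>r. lower_order (dominance r)) ` carrier (CDyer n)"
      using fixed[of t] by (intro image_eqI[of _ _ t]) auto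
  qed (use in_carrier in auto)
  have po: "partial_order (CTam312 n)"
    unfolding CTam312_def by (rule CDyer_subset_partial_order) auto
  note hom = complete_lattice_hom_if_adjoints[OF CDyer_complete_lattice po image,
      where e = "\<lambda>t. t" and g = "\<lambda>t. upper_order (dominance t)"]
  have adj: "t \<sqsubseteq>\<^bsub>CTam312 n\<^esub> lower_order (dominance r) \<longleftrightarrow> t \<sqsubseteq>\<^bsub>CDyer n\<^esub> r"
    "lower_order (dominance r) \<sqsubseteq>\<^bsub>CTam312 n\<^esub> t \<longleftrightarrow> r \<sqsubseteq>\<^bsub>CDyer n\<^esub> upper_order (dominance t)"
    if "r \<in> carrier (CDyer n)" "t \<in> carrier (CTam312 n)" for r t
    using lower_order_le_iff[of t n r] le_upper_order_iff[of t n r] fixed[OF that(2)] that(1)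
    by (simp_all add: le)
  show "complete_lattice (CTam312 n)"
    by (rule hom(1)) (use adj fixed upper_dominance_TITO in auto)
  show "complete_lattice_hom (CDyer n) (CTam312 n) (\<lambda>r. lower_order (dominance r))"
    by (rule hom(2)) (use adj fixed upper_dominance_TITO in auto)
qed

text \<open>The same adjunctions as for the lower projection, read through the bijection \<open>post_order\<close>: the post-order
  of the tree of \<open>r\<close> is the lower projection of \<open>r\<close>.\<close>

lemma CTamTree_hom:
  assumes n: "n \<ge> 1"
  shows "complete_lattice (CTamTree n)"
    and "complete_lattice_hom (CDyer n) (CTamTree n) (tree_of n)"
proof -
  have carrier: "carrier (CTamTree n) = TIBIT n" by (simp add: CTamTree_def)
  have le: "S \<sqsubseteq>\<^bsub>CTamTree n\<^esub> T \<longleftrightarrow> post_order S \<sqsubseteq>\<^bsub>CDyer n\<^esub> post_order T" for S T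
    by (simp add: CTamTree_def)
  have post: "post_order T \<in> TITO n" "lower_order (dominance (post_order T)) = post_order T"
    if "T \<in> TIBIT n" for T
  proof -
    interpret tibit n T by standard (rule that)
    show "post_order T \<in> TITO n" "lower_order (dominance (post_order T)) = post_order T"
      using post_order_TITO post_order_eq dominance_post_order by simp_all
  qed
  have image: "tree_of n ` carrier (CDyer n) = carrier (CTamTree n)"
    using tree_of_image[OF n] carrier by simp
  have po: "partial_order (CTamTree n)"
  proof -
    interpret D: partial_order "CDyer n" by (rule CDyer_partial_order)
    have inj: "S = T" if "post_order S = post_order T" "S \<in> TIBIT n" "T \<in> TIBIT n" for S T
      using that tree_of_post_order[OF n] by metis
    show ?thesis
    proof
      show "x \<sqsubseteq>\<^bsub>CTamTree n\<^esub> z" if "x \<sqsubseteq>\<^bsub>CTamTree n\<^esub> y" "y \<sqsubseteq>\<^bsub>CTamTree n\<^esub> z"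
        "x \<in> carrier (CTamTree n)" "y \<in> carrier (CTamTree n)" "z \<in> carrier (CTamTree n)" for x y z
        using that D.le_trans[of "post_order x" "post_order y" "post_order z"] post
        by (simp add: le carrier)
      show "x .=\<^bsub>CTamTree n\<^esub> y" if "x \<sqsubseteq>\<^bsub>CTamTree n\<^esub> y" "y \<sqsubseteq>\<^bsub>CTamTree n\<^esub> x"
        "x \<in> carrier (CTamTree n)" "y \<in> carrier (CTamTree n)" for x y
        using that D.le_antisym[of "post_order x" "post_order y"] post inj[of x y]
        by (simp add: le carrier) (simp add: CTamTree_def)
    qed (use post in \<open>auto simp: CTamTree_def\<close>)
  qed
  note hom = complete_lattice_hom_if_adjoints[OF CDyer_complete_lattice po image,
      where e = post_order and g = "\<lambda>T. upper_order (dominance (post_order T))"]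
  have adj: "T \<sqsubseteq>\<^bsub>CTamTree n\<^esub> tree_of n r \<longleftrightarrow> post_order T \<sqsubseteq>\<^bsub>CDyer n\<^esub> r"
    "tree_of n r \<sqsubseteq>\<^bsub>CTamTree n\<^esub> T \<longleftrightarrow> r \<sqsubseteq>\<^bsub>CDyer n\<^esub> upper_order (dominance (post_order T))"
    if "r \<in> carrier (CDyer n)" "T \<in> carrier (CTamTree n)" for r T
    using lower_order_le_iff[of "post_order T" n r] le_upper_order_iff[of "post_order T" n r]
      post[of T] that post_order_tree_of[OF n, of r]
    by (simp_all add: le carrier)
  show "complete_lattice (CTamTree n)"
    by (rule hom(1)) (use adj post upper_dominance_TITO carrier in auto)
  show "complete_lattice_hom (CDyer n) (CTamTree n) (tree_of n)"
    by (rule hom(2)) (use adj post upper_dominance_TITO carrier in auto)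
qed

text \<open>The minimum of the class of \<open>r\<close> is its lower projection, so the minima of the classes
  form exactly the lattice of \<open>312\<close>-avoiding orders.\<close>

lemma cyclic_sylvester_congruence:
  assumes n: "n \<ge> 1"
  shows "complete_lattice_congruence (CDyer n) (cyclic_sylvester n)"
proof -
  let ?E = "cyclic_sylvester n"
  interpret D: partial_order "CDyer n" by (rule CDyer_partial_order)
  have equiv: "equiv (TITO n) ?E"
    by (rule equivI) (auto simp: cyclic_sylvester_def refl_on_def sym_def trans_def)
  have cls: "?E `` {r} = \<lbrace>lower_order (dominance r)..upper_order (dominance r)\<rbrace>\<^bsub>CDyer n\<^esub>"
    if r: "r \<in> TITO n" for r
    unfolding dominance_class_is_interval[OF r, symmetric]
    using r tree_of_eq_iff[OF n r] by (auto simp: cyclic_sylvester_def)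
  have least: "least (CDyer n) (lower_order (dominance r)) (?E `` {r})" if r: "r \<in> TITO n" for r
    unfolding cls[OF r] least_def
    using lower_dominance_TITO[OF r] lower_order_le_upper_order[OF r]
    by (auto simp: at_least_at_most_def)
  have class_min: "class_min (CDyer n) ?E r = lower_order (dominance r)" if r: "r \<in> TITO n" for r
    unfolding class_min_def
    by (rule the_equality) (rule least[OF r], rule D.least_unique[OF _ least[OF r]])
  have minima: "class_minima (CDyer n) ?E = CTam312 n"
  proof -
    have "{m. \<exists>C \<in> TITO n // ?E. least (CDyer n) m C} = {r \<in> TITO n. avoids_312 r}"
    proof (intro equalityI subsetI)
      fix m assume "m \<in> {m. \<exists>C \<in> TITO n // ?E. least (CDyer n) m C}"
      then obtain r where r: "r \<in> TITO n" and m: "least (CDyer n) m (?E `` {r})"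
        by (auto simp: quotient_def)
      have "m = lower_order (dominance r)" using D.least_unique[OF m least[OF r]] .
      then show "m \<in> {r \<in> TITO n. avoids_312 r}"
        using r lower_dominance_TITO descendant_order.lower_order_avoids_312[OF TITO_dominance] by blast
    next
      fix m assume "m \<in> {r \<in> TITO n. avoids_312 r}"
      then have "m \<in> TITO n" "lower_order (dominance m) = m"
        using eq_lower_order_if_avoids_312[OF TITO_linear] by auto
      then show "m \<in> {m. \<exists>C \<in> TITO n // ?E. least (CDyer n) m C}"
        using least[of m] quotientI[of m "TITO n" ?E] by auto
    qed
    then show ?thesis by (simp add: class_minima_def CTam312_def)
  qed
  have "is_interval (CDyer n) C" if C: "C \<in> TITO n // ?E" for C
  proof -
    obtain r where r: "r \<in> TITO n" "C = ?E `` {r}" using C by (rule quotientE)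
    show ?thesis
      unfolding is_interval_def r(2) cls[OF r(1)] carrier_CDyer
      using lower_dominance_TITO[OF r(1)] upper_dominance_TITO[OF r(1)] lower_order_le_upper_order[OF r(1)]
      by blast
  qed
  moreover have "complete_lattice_hom (CDyer n) (CTam312 n) (class_min (CDyer n) ?E)"
  proof -
    have same: "class_min (CDyer n) ?E ` A = (\<lambda>r. lower_order (dominance r)) ` A" if "A \<subseteq> TITO n" for A
      using that class_min by (intro image_cong) auto
    interpret L: complete_lattice "CDyer n" by (rule CDyer_complete_lattice)
    show ?thesis
      using CTam312_hom(2)[of n] L.sup_closed L.inf_closed
      by (simp add: complete_lattice_hom_def sup_pres_def inf_pres_def same class_min)
  qed
  ultimately show ?thesis
    unfolding complete_lattice_congruence_def minima
    using equiv CDyer_complete_lattice CTam312_hom(1) by auto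
qed

theorem theorem4p12:
  fixes n :: int
  assumes "n \<ge> 2"
  shows "(lattice (CTam312 n) \<and> finite (carrier (CTam312 n))) \<and>
         (lattice (CTamTree n) \<and> finite (carrier (CTamTree n))) \<and>
         complete_lattice_congruence (CDyer n) (cyclic_sylvester n) \<and>
         complete_lattice_hom (CDyer n) (CTamTree n) (tree_of n) \<and>
         tree_of n ` carrier (CDyer n) = carrier (CTamTree n)"
proof -
  have n: "n \<ge> 1" using assms by simp
  have fin: "finite (carrier (CTam312 n))"
    using finite_312_avoiding[OF n] by (simp add: CTam312_def)
  \<comment> \<open>Every TIBIT is the tree of its own post-order, which avoids 312.\<close>
  have "TIBIT n \<subseteq> tree_of n ` {r \<in> TITO n. avoids_312 r}"
  proof
    fix T assume T: "T \<in> TIBIT n"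
    interpret tibit n T by standard (rule T)
    have "post_order T \<in> {r \<in> TITO n. avoids_312 r}"
      using post_order_TITO post_order_eq lower_order_avoids_312 by simp
    then show "T \<in> tree_of n ` {r \<in> TITO n. avoids_312 r}"
      using tree_of_post_order[OF n T] by (metis image_eqI)
  qed
  then have "finite (TIBIT n)"
    using finite_312_avoiding[OF n] by (meson finite_surj)
  then have "finite (carrier (CTamTree n))" by (simp add: CTamTree_def)
  moreover have "lattice (CTam312 n)" "lattice (CTamTree n)"
    using CTam312_hom(1) CTamTree_hom(1)[OF n] by (simp_all add: complete_lattice_lattice)
  moreover have "tree_of n ` carrier (CDyer n) = carrier (CTamTree n)"
    using tree_of_image[OF n] by (simp add: CTamTree_def)
  ultimately show ?thesis
    using fin cyclic_sylvester_congruence[OF n] CTamTree_hom(2)[OF n] by blast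
qed

end
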